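(* Let $n\ge1$ and let $U$ be a depth-$d$ $\mathrm{QAC}^0$ circuit on $n+a$ qubits, with $n$ input qubits and $a$ ancilla qubits initialized in a density operator $\varphi$ on $a$ qubits. Let $p:\{0,1\}^n\to\mathbb R$ be the probability that $U$ outputs $1$, i.e. $p(x)=\mathrm{Tr}\big[(|1\rangle\langle1|\otimes I)\,U(|x\rangle\langle x|\otimes\varphi)U^\dagger\big]$. Then $\deg_\varepsilon(p)=\tilde O\big((n+a)^{1-3^{-d}}\big)$ for $\varepsilon=O(d/n)$.
   Context: For $f:\{0,1\}^n\to\mathbb R$ write $f=\sum_{S\subseteq[n]}\hat f(S)\chi_S$ with $\chi_S(x)=(-1)^{\sum_{i\in S}x_i}$; $\deg(f)=\max\{|S|:\hat f(S)\ne0\}$ and $\deg_\varepsilon(f)=\min\{\deg(g):\max_x|f(x)-g(x)|\le\varepsilon\}$. A depth-$d$ $\mathrm{QAC}^0$ circuit on $m$ qubits is a unitary $U=L_dM_d\cdots L_1M_1L_0$ where each $L_i$ is a tensor product of single-qubit unitaries and each $M_i$ is a tensor product of multi-qubit CZ gates $I-2|1^s\rangle\langle1^s|$ on pairwise disjoint sets of qubits. $O(\cdot)$ hides an absolute constant; $\tilde O(\cdot)$ hides absolute constants and polylogarithmic factors in $n+a$. *)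

theory Defs
  imports "Jordan_Normal_Form.Matrix" "Jordan_Normal_Form.Schur_Decomposition"
    "HOL-Library.Complex_Order"
begin

text \<open>Computational basis states of an m-qubit register are indexed by i < 2^m;
  qubit k of basis state i is bit k of i.\<close>
definition qbit :: "nat \<Rightarrow> nat \<Rightarrow> bool" where
  "qbit i k \<longleftrightarrow> odd (i div 2 ^ k)"

definition unitary_mat :: "nat \<Rightarrow> complex mat \<Rightarrow> bool" where
  "unitary_mat N U \<longleftrightarrow> U \<in> carrier_mat N N \<and> mat_adjoint U * U = 1\<^sub>m N \<and> U * mat_adjoint U = 1\<^sub>m N"

text \<open>Tensor product of single-qubit operators u 0, ..., u (m-1).\<close>
definition single_qubit_layer :: "nat \<Rightarrow> (nat \<Rightarrow> complex mat) \<Rightarrow> complex mat" where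
  "single_qubit_layer m u = mat (2 ^ m) (2 ^ m)
     (\<lambda>(i, j). \<Prod>k<m. u k $$ (if qbit i k then 1 else 0, if qbit j k then 1 else 0))"

definition is_single_qubit_layer :: "nat \<Rightarrow> complex mat \<Rightarrow> bool" where
  "is_single_qubit_layer m L \<longleftrightarrow>
     (\<exists>u. (\<forall>k<m. unitary_mat 2 (u k)) \<and> L = single_qubit_layer m u)"

text \<open>Tensor product of multi-qubit CZ gates I - 2|1^s><1^s| on the sets of qubits in F
  (identity on the remaining qubits).\<close>
definition cz_layer :: "nat \<Rightarrow> nat set set \<Rightarrow> complex mat" where
  "cz_layer m F = mat (2 ^ m) (2 ^ m)
     (\<lambda>(i, j). if i = j then (\<Prod>S\<in>F. if (\<forall>k\<in>S. qbit i k) then -1 else 1) else 0)"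

definition is_cz_layer :: "nat \<Rightarrow> complex mat \<Rightarrow> bool" where
  "is_cz_layer m M \<longleftrightarrow>
     (\<exists>F. (\<forall>S\<in>F. S \<noteq> {} \<and> S \<subseteq> {..<m}) \<and> (\<forall>S\<in>F. \<forall>T\<in>F. S \<noteq> T \<longrightarrow> S \<inter> T = {})
          \<and> M = cz_layer m F)"

fun qac0_compose :: "(nat \<Rightarrow> complex mat) \<Rightarrow> (nat \<Rightarrow> complex mat) \<Rightarrow> nat \<Rightarrow> complex mat" where
  "qac0_compose L M 0 = L 0"
| "qac0_compose L M (Suc l) = L (Suc l) * M (Suc l) * qac0_compose L M l"

definition qac0_circuit :: "nat \<Rightarrow> nat \<Rightarrow> complex mat \<Rightarrow> bool" where
  "qac0_circuit m d U \<longleftrightarrow>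
     (\<exists>L M. (\<forall>l\<le>d. is_single_qubit_layer m (L l)) \<and> (\<forall>l\<in>{1..d}. is_cz_layer m (M l))
            \<and> U = qac0_compose L M d)"

definition mtrace :: "complex mat \<Rightarrow> complex" where
  "mtrace A = (\<Sum>i<dim_row A. A $$ (i, i))"

definition density_operator :: "nat \<Rightarrow> complex mat \<Rightarrow> bool" where
  "density_operator a \<phi> \<longleftrightarrow> \<phi> \<in> carrier_mat (2 ^ a) (2 ^ a)
     \<and> (\<forall>v\<in>carrier_vec (2 ^ a). 0 \<le> (\<phi> *\<^sub>v v) \<bullet>c v) \<and> mtrace \<phi> = 1"

text \<open>|x><x| (x on the n input qubits 0..n-1, given as the set of coordinates equal to 1)
  tensor \<phi> (on the ancilla qubits n..n+a-1).\<close>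
definition input_state :: "nat \<Rightarrow> nat \<Rightarrow> nat set \<Rightarrow> complex mat \<Rightarrow> complex mat" where
  "input_state n a x \<phi> = mat (2 ^ (n + a)) (2 ^ (n + a))
     (\<lambda>(i, j). if (\<forall>k<n. (qbit i k \<longleftrightarrow> k \<in> x) \<and> (qbit j k \<longleftrightarrow> k \<in> x))
               then \<phi> $$ (i div 2 ^ n, j div 2 ^ n) else 0)"

text \<open>|1><1| on the first (output) qubit tensor identity.\<close>
definition proj_one :: "nat \<Rightarrow> complex mat" where
  "proj_one m = mat (2 ^ m) (2 ^ m) (\<lambda>(i, j). if i = j \<and> qbit i 0 then 1 else 0)"

definition accept_prob :: "nat \<Rightarrow> nat \<Rightarrow> complex mat \<Rightarrow> complex mat \<Rightarrow> nat set \<Rightarrow> real" where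
  "accept_prob n a U \<phi> x =
     Re (mtrace (proj_one (n + a) * (U * input_state n a x \<phi> * mat_adjoint U)))"

text \<open>Points of {0,1}^n are represented by the set of coordinates (in {..<n}) equal to 1.\<close>
definition chi :: "nat set \<Rightarrow> nat set \<Rightarrow> real" where
  "chi S x = (-1) ^ card (S \<inter> x)"

definition fourier_coeff :: "nat \<Rightarrow> (nat set \<Rightarrow> real) \<Rightarrow> nat set \<Rightarrow> real" where
  "fourier_coeff n f S = (\<Sum>x\<in>Pow {..<n}. f x * chi S x) / 2 ^ n"

definition fdeg :: "nat \<Rightarrow> (nat set \<Rightarrow> real) \<Rightarrow> nat" where
  "fdeg n f = Max (insert 0 {card S | S. S \<subseteq> {..<n} \<and> fourier_coeff n f S \<noteq> 0})"

definition approx_deg :: "nat \<Rightarrow> real \<Rightarrow> (nat set \<Rightarrow> real) \<Rightarrow> nat" where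
  "approx_deg n \<epsilon> f =
     (LEAST D. \<exists>g. fdeg n g = D \<and> (\<forall>x\<in>Pow {..<n}. \<bar>f x - g x\<bar> \<le> \<epsilon>))"

end

theory Submission
  imports Defs "HOL-Library.Nat_Bijection" "HOL-Library.Disjoint_Sets"
begin

text \<open>
  Work in the Heisenberg picture, writing \<open>N = n + a\<close>, and call an operator of degree \<open>y\<close> if it is
  a sum of operators each acting on at most \<open>y\<close> qubits. The output projector has degree 1, and an
  operator of degree \<open>y\<close> gives an acceptance probability of Fourier degree at most \<open>y\<close>. Conjugation
  by a layer of single-qubit unitaries preserves the degree. In a CZ layer, fix a threshold \<open>D\<close>.
  Gates on at most \<open>D\<close> qubits multiply the degree by at most \<open>D\<close>. A gate on \<open>s > D\<close> qubits is
  diagonal and is replaced by a polynomial of degree \<open>O(sqrt s log N)\<close> in the Hamming weight,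
  built from a power of a Chebyshev polynomial; the replaced gates act on disjoint sets, so together
  they add only \<open>O(N log N / sqrt D)\<close>. For a suitable \<open>K = O(N log N)\<close> the choice
  \<open>D = (K / 3 y)\<^bsup>2/3\<^esup>\<close> balances both contributions and turns \<open>y\<close> into at most \<open>y\<^bsup>1/3\<^esup> K\<^bsup>2/3\<^esup>\<close>, so
  after \<open>d\<close> layers the degree is at most \<open>K\<^bsup>1 - 1/3^d\<^esup>\<close>. The replacement gates are contractions, so
  the errors of the layers add up; they are measured in the seminorm
  \<open>W \<mapsto> sqrt (Tr (W \<rho> W\<^sup>*))\<close> of the initial state \<open>\<rho>\<close>.
\<close>

subsection \<open>Adjoints and traces of complex matrices\<close>

lemmas square_mult_assoc = assoc_mult_mat[of _ N N _ N _ N] for N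

lemmas square_mult_one = left_mult_one_mat[of _ N N] right_mult_one_mat[of _ N N] for N

lemmas square_mat_distribs =
  add_mult_distrib_mat[of _ N N _ _ N] mult_add_distrib_mat[of _ N N _ N]
  minus_mult_distrib_mat[of _ N N _ _ N] mult_minus_distrib_mat[of _ N N _ N]
  mult_smult_distrib[of _ N N _ N] mult_smult_assoc_mat[of _ N N _ N]
  add_smult_distrib_left_mat[of _ N N] for N

lemma mult_square_carrier [simp]:
  "A \<in> carrier_mat n n \<Longrightarrow> B \<in> carrier_mat n n \<Longrightarrow> A * B \<in> carrier_mat n n"
  by (rule mult_carrier_mat)

lemma mat_adjoint_carrier [simp]:
  "A \<in> carrier_mat n k \<Longrightarrow> mat_adjoint A \<in> carrier_mat k n"
  by (auto simp: mat_adjoint_def)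

lemma dim_mat_adjoint [simp]:
  "dim_row (mat_adjoint A) = dim_col A" "dim_col (mat_adjoint A) = dim_row A"
  by (simp_all add: mat_adjoint_def)

lemma index_mat_adjoint [simp]:
  fixes A :: "complex mat"
  assumes "i < dim_col A" "j < dim_row A"
  shows "mat_adjoint A $$ (i, j) = cnj (A $$ (j, i))"
  using assms by (simp add: mat_adjoint_def mat_of_rows_index)

lemma mat_adjoint_add:
  fixes A B :: "complex mat"
  assumes "A \<in> carrier_mat n k" "B \<in> carrier_mat n k"
  shows "mat_adjoint (A + B) = mat_adjoint A + mat_adjoint B"
  using assms by (intro eq_matI) auto

lemma mat_adjoint_smult: "mat_adjoint (c \<cdot>\<^sub>m A) = cnj c \<cdot>\<^sub>m mat_adjoint (A :: complex mat)"
  by (rule eq_matI) simp_all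

lemma mat_adjoint_mult:
  fixes A B :: "complex mat"
  assumes "A \<in> carrier_mat n k" "B \<in> carrier_mat k l"
  shows "mat_adjoint (A * B) = mat_adjoint B * mat_adjoint A"
  using assms
  by (intro eq_matI) (auto simp: scalar_prod_def mult.commute intro!: sum.cong)

lemma mtrace_add:
  assumes "A \<in> carrier_mat n n" "B \<in> carrier_mat n n"
  shows "mtrace (A + B) = mtrace A + mtrace B"
  using assms by (simp add: mtrace_def sum.distrib)

lemma mtrace_smult: "A \<in> carrier_mat n n \<Longrightarrow> mtrace (c \<cdot>\<^sub>m A) = c * mtrace A"
  by (simp add: mtrace_def sum_distrib_left)

lemma mtrace_mult_commute:
  assumes "A \<in> carrier_mat n k" "B \<in> carrier_mat k n"
  shows "mtrace (A * B) = mtrace (B * A)"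
proof -
  have "mtrace (A * B) = (\<Sum>i<n. \<Sum>j<k. A $$ (i, j) * B $$ (j, i))"
    using assms by (simp add: mtrace_def scalar_prod_def atLeast0LessThan)
  also have "\<dots> = (\<Sum>j<k. \<Sum>i<n. B $$ (j, i) * A $$ (i, j))"
    by (subst sum.swap) (simp add: mult.commute)
  also have "\<dots> = mtrace (B * A)"
    using assms by (simp add: mtrace_def scalar_prod_def atLeast0LessThan)
  finally show ?thesis .
qed

subsection \<open>Operators on a qubit register, indexed by sets of qubits\<close>

abbreviation operators :: "nat \<Rightarrow> complex mat set" where
  "operators m \<equiv> carrier_mat (2 ^ m) (2 ^ m)"

text \<open>A basis state is identified with the set of its qubits in state 1.\<close>

definition set_entry :: "complex mat \<Rightarrow> nat set \<Rightarrow> nat set \<Rightarrow> complex" where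
  "set_entry A X Y = A $$ (set_encode X, set_encode Y)"

lemma qbit_iff_set_decode: "qbit i k \<longleftrightarrow> k \<in> set_decode i"
  by (simp add: qbit_def set_decode_def)

lemma qbit_set_encode: "X \<subseteq> {..<m} \<Longrightarrow> qbit (set_encode X) k \<longleftrightarrow> k \<in> X"
  by (simp add: qbit_iff_set_decode finite_subset)

lemma set_encode_eq_iff:
  "X \<subseteq> {..<m} \<Longrightarrow> Y \<subseteq> {..<m} \<Longrightarrow> set_encode X = set_encode Y \<longleftrightarrow> X = Y"
  using set_encode_eq finite_subset by blast

lemma set_encode_less:
  assumes "X \<subseteq> {..<m}"
  shows "set_encode X < 2 ^ m"
proof -
  have "set_encode X \<le> (\<Sum>k<m. 2 ^ k)"
    unfolding set_encode_def using assms by (intro sum_mono2) auto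
  also have "\<dots> < 2 ^ m" unfolding lessThan_atLeast0 sum_power2 by simp
  finally show ?thesis .
qed

lemma set_decode_subset:
  assumes "i < 2 ^ m"
  shows "set_decode i \<subseteq> {..<m}"
proof (rule subsetI, rule ccontr)
  fix k assume k: "k \<in> set_decode i" "k \<notin> {..<m}"
  then have "(2 :: nat) ^ m \<le> 2 ^ k" by simp
  with assms have "i < 2 ^ k" by linarith
  then show False using k(1) by (simp add: set_decode_def)
qed

lemma bij_betw_set_encode: "bij_betw set_encode (Pow {..<m}) {..<2 ^ m}"
  by (rule bij_betw_byWitness[where f' = set_decode])
    (use set_encode_less set_decode_subset finite_subset in \<open>force+\<close>)

lemma sum_set_encode: "(\<Sum>i<2 ^ m. f i) = (\<Sum>X\<in>Pow {..<m}. f (set_encode X))"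
  using sum.reindex_bij_betw[OF bij_betw_set_encode, of f m] by simp

lemma operators_eqI:
  assumes "A \<in> operators m" "B \<in> operators m"
    and "\<And>X Y. X \<subseteq> {..<m} \<Longrightarrow> Y \<subseteq> {..<m} \<Longrightarrow> set_entry A X Y = set_entry B X Y"
  shows "A = B"
proof (rule eq_matI)
  fix i j assume "i < dim_row B" "j < dim_col B"
  with assms(2) have "set_decode i \<subseteq> {..<m}" "set_decode j \<subseteq> {..<m}"
    by (auto intro!: set_decode_subset)
  from assms(3)[OF this] show "A $$ (i, j) = B $$ (i, j)" by (simp add: set_entry_def)
qed (use assms in auto)

lemma set_entry_mat:
  "X \<subseteq> {..<m} \<Longrightarrow> Y \<subseteq> {..<m} \<Longrightarrow>
    set_entry (mat (2 ^ m) (2 ^ m) f) X Y = f (set_encode X, set_encode Y)"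
  by (simp add: set_entry_def set_encode_less)

lemma set_entry_one:
  "X \<subseteq> {..<m} \<Longrightarrow> Y \<subseteq> {..<m} \<Longrightarrow> set_entry (1\<^sub>m (2 ^ m)) X Y = of_bool (X = Y)"
  by (simp add: set_entry_def set_encode_less set_encode_eq_iff)

lemma set_entry_add:
  assumes "A \<in> operators m" "B \<in> operators m" "X \<subseteq> {..<m}" "Y \<subseteq> {..<m}"
  shows "set_entry (A + B) X Y = set_entry A X Y + set_entry B X Y"
  using assms by (simp add: set_entry_def set_encode_less)

lemma set_entry_smult:
  assumes "A \<in> operators m" "X \<subseteq> {..<m}" "Y \<subseteq> {..<m}"
  shows "set_entry (c \<cdot>\<^sub>m A) X Y = c * set_entry A X Y"
  using assms by (simp add: set_entry_def set_encode_less)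

lemma set_entry_mult:
  assumes "A \<in> operators m" "B \<in> operators m" "X \<subseteq> {..<m}" "Y \<subseteq> {..<m}"
  shows "set_entry (A * B) X Y = (\<Sum>Z\<in>Pow {..<m}. set_entry A X Z * set_entry B Z Y)"
  using assms
  by (simp add: set_entry_def scalar_prod_def atLeast0LessThan sum_set_encode set_encode_less)

lemma set_entry_adjoint:
  assumes "A \<in> operators m" "X \<subseteq> {..<m}" "Y \<subseteq> {..<m}"
  shows "set_entry (mat_adjoint A) X Y = cnj (set_entry A Y X)"
  using assms by (simp add: set_entry_def set_encode_less)

lemma mtrace_set_entry: "A \<in> operators m \<Longrightarrow> mtrace A = (\<Sum>X\<in>Pow {..<m}. set_entry A X X)"
  by (simp add: mtrace_def set_entry_def sum_set_encode)

subsection \<open>Support of an operator\<close>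

definition supported_on :: "nat \<Rightarrow> nat set \<Rightarrow> complex mat \<Rightarrow> bool" where
  "supported_on m S A \<longleftrightarrow> A \<in> operators m \<and> (\<forall>X\<subseteq>{..<m}. \<forall>Y\<subseteq>{..<m}.
     set_entry A X Y = (if X - S = Y - S then set_entry A (X \<inter> S) (Y \<inter> S) else 0))"

lemma supported_onI:
  assumes "A \<in> operators m"
    and "\<And>X Y. X \<subseteq> {..<m} \<Longrightarrow> Y \<subseteq> {..<m} \<Longrightarrow>
      set_entry A X Y = (if X - S = Y - S then set_entry A (X \<inter> S) (Y \<inter> S) else 0)"
  shows "supported_on m S A"
  using assms by (simp add: supported_on_def)

lemma supported_onD:
  "supported_on m S A \<Longrightarrow> X \<subseteq> {..<m} \<Longrightarrow> Y \<subseteq> {..<m} \<Longrightarrow>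
    set_entry A X Y = (if X - S = Y - S then set_entry A (X \<inter> S) (Y \<inter> S) else 0)"
  by (simp add: supported_on_def)

lemma supported_on_carrier: "supported_on m S A \<Longrightarrow> A \<in> operators m"
  by (simp add: supported_on_def)

lemma supported_on_lessThan:
  assumes "A \<in> operators m"
  shows "supported_on m {..<m} A"
proof (rule supported_onI[OF assms])
  fix X Y :: "nat set"
  assume "X \<subseteq> {..<m}" "Y \<subseteq> {..<m}"
  then have "X - {..<m} = Y - {..<m}" "X \<inter> {..<m} = X" "Y \<inter> {..<m} = Y"
    by blast+
  then show "set_entry A X Y =
      (if X - {..<m} = Y - {..<m} then set_entry A (X \<inter> {..<m}) (Y \<inter> {..<m}) else 0)"
    by (simp only: refl if_True)
qed

lemma supported_on_mono:
  assumes A: "supported_on m S A" and "S \<subseteq> S'"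
  shows "supported_on m S' A"
proof (rule supported_onI[OF supported_on_carrier[OF A]])
  fix X Y :: "nat set"
  assume XY: "X \<subseteq> {..<m}" "Y \<subseteq> {..<m}"
  then have "X \<inter> S' \<subseteq> {..<m}" "Y \<inter> S' \<subseteq> {..<m}" by auto
  note inner = supported_onD[OF A this]
  have "X - S = Y - S \<longleftrightarrow> X - S' = Y - S' \<and> X \<inter> S' - S = Y \<inter> S' - S"
    "X \<inter> S' \<inter> S = X \<inter> S" "Y \<inter> S' \<inter> S = Y \<inter> S"
    using \<open>S \<subseteq> S'\<close> by blast+
  then show "set_entry A X Y =
      (if X - S' = Y - S' then set_entry A (X \<inter> S') (Y \<inter> S') else 0)"
    unfolding inner supported_onD[OF A XY] by simp
qed

lemma supported_on_smult:
  assumes "supported_on m S A"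
  shows "supported_on m S (c \<cdot>\<^sub>m A)"
proof -
  note [simp] = set_entry_smult[OF supported_on_carrier[OF assms]]
  show ?thesis
    using supported_onD[OF assms] supported_on_carrier[OF assms]
    by (intro supported_onI) (auto simp: le_infI1)
qed

lemma supported_on_adjoint:
  assumes "supported_on m S A"
  shows "supported_on m S (mat_adjoint A)"
proof -
  note [simp] = set_entry_adjoint[OF supported_on_carrier[OF assms]]
  show ?thesis
    using supported_on_carrier[OF assms] supported_onD[OF assms, of Y X for X Y]
    by (intro supported_onI) (auto simp: le_infI1)
qed

lemma set_entry_mult_supported:
  assumes S: "S \<subseteq> {..<m}" and A: "supported_on m S A" and B: "B \<in> operators m"
    and XY: "X \<subseteq> {..<m}" "Y \<subseteq> {..<m}"
  shows "set_entry (A * B) X Y =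
    (\<Sum>P\<in>Pow S. set_entry A (X \<inter> S) P * set_entry B (P \<union> (X - S)) Y)"
proof -
  have "set_entry (A * B) X Y = (\<Sum>Z\<in>Pow {..<m}. set_entry A X Z * set_entry B Z Y)"
    by (rule set_entry_mult[OF supported_on_carrier[OF A] B XY])
  also have "\<dots> = (\<Sum>Z\<in>Pow {..<m}. if Z - S = X - S
      then set_entry A (X \<inter> S) (Z \<inter> S) * set_entry B Z Y else 0)"
    using supported_onD[OF A XY(1)] by (intro sum.cong refl) auto
  also have "\<dots> = (\<Sum>Z\<in>{Z \<in> Pow {..<m}. Z - S = X - S}.
      set_entry A (X \<inter> S) (Z \<inter> S) * set_entry B Z Y)"
    by (rule sum.inter_filter[symmetric]) simp
  also have "\<dots> = (\<Sum>P\<in>Pow S. set_entry A (X \<inter> S) P * set_entry B (P \<union> (X - S)) Y)"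
  proof (rule sum.reindex_bij_witness[of _ "\<lambda>P. P \<union> (X - S)" "\<lambda>Z. Z \<inter> S"])
    fix Z assume "Z \<in> {Z \<in> Pow {..<m}. Z - S = X - S}"
    then show "Z \<inter> S \<union> (X - S) = Z" by blast
    then show "set_entry A (X \<inter> S) (Z \<inter> S) * set_entry B (Z \<inter> S \<union> (X - S)) Y =
        set_entry A (X \<inter> S) (Z \<inter> S) * set_entry B Z Y" by simp
  qed (use S XY in auto)
  finally show ?thesis .
qed

lemma supported_on_mult:
  assumes S: "S \<subseteq> {..<m}" and A: "supported_on m S A" and B: "supported_on m S B"
  shows "supported_on m S (A * B)"
proof (rule supported_onI)
  note [simp] = supported_on_carrier[OF A] supported_on_carrier[OF B]
  show "A * B \<in> operators m" by simp
  fix X Y :: "nat set"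
  assume XY: "X \<subseteq> {..<m}" "Y \<subseteq> {..<m}"
  have "set_entry B (P \<union> (X - S)) Y =
      (if X - S = Y - S then set_entry B (P \<union> (X \<inter> S - S)) (Y \<inter> S) else 0)"
    if "P \<in> Pow S" for P
  proof -
    have "P \<union> (X - S) \<subseteq> {..<m}" "P \<union> (X - S) - S = X - S" "(P \<union> (X - S)) \<inter> S = P"
      "P \<union> (X \<inter> S - S) = P"
      using that S XY by auto
    then show ?thesis using supported_onD[OF B _ XY(2), of "P \<union> (X - S)"] by (simp only:)
  qed
  moreover have "X \<inter> S \<subseteq> {..<m}" "Y \<inter> S \<subseteq> {..<m}" using XY by auto
  ultimately show "set_entry (A * B) X Y =
      (if X - S = Y - S then set_entry (A * B) (X \<inter> S) (Y \<inter> S) else 0)"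
    using XY by (simp add: set_entry_mult_supported[OF S A])
qed

lemma set_entry_mult_disjoint_supports:
  assumes S: "S \<subseteq> {..<m}" and A: "supported_on m S A" and B: "supported_on m ({..<m} - S) B"
    and XY: "X \<subseteq> {..<m}" "Y \<subseteq> {..<m}"
  shows "set_entry (A * B) X Y =
    set_entry A (X \<inter> S) (Y \<inter> S) * set_entry B (X - S) (Y - S)"
proof -
  have "finite S" using S finite_subset by blast
  have "set_entry B (P \<union> (X - S)) Y = (if P = Y \<inter> S then set_entry B (X - S) (Y - S) else 0)"
    if "P \<in> Pow S" for P
  proof -
    have "P \<union> (X - S) \<subseteq> {..<m}" "P \<union> (X - S) - ({..<m} - S) = P"
      "(P \<union> (X - S)) \<inter> ({..<m} - S) = X - S"
      "Y - ({..<m} - S) = Y \<inter> S" "Y \<inter> ({..<m} - S) = Y - S"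
      using that S XY by auto
    then show ?thesis using supported_onD[OF B _ XY(2), of "P \<union> (X - S)"] by (simp only:)
  qed
  then have "set_entry (A * B) X Y = (\<Sum>P\<in>Pow S. if P = Y \<inter> S
      then set_entry A (X \<inter> S) P * set_entry B (X - S) (Y - S) else 0)"
    unfolding set_entry_mult_supported[OF S A supported_on_carrier[OF B] XY]
    by (intro sum.cong) auto
  then show ?thesis using \<open>finite S\<close> by simp
qed

lemma supported_on_mult_commute:
  assumes S: "S \<subseteq> {..<m}" and A: "supported_on m S A" and B: "supported_on m ({..<m} - S) B"
  shows "A * B = B * A"
proof (rule operators_eqI)
  show "A * B \<in> operators m" "B * A \<in> operators m"
    using supported_on_carrier[OF A] supported_on_carrier[OF B] by simp_all
  fix X Y :: "nat set"
  assume XY: "X \<subseteq> {..<m}" "Y \<subseteq> {..<m}"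
  have compl: "X - ({..<m} - S) = X \<inter> S" "X \<inter> ({..<m} - S) = X - S" if "X \<subseteq> {..<m}" for X
    using that by auto
  have "{..<m} - ({..<m} - S) = S" using S by auto
  then have "set_entry (B * A) X Y = set_entry B (X - S) (Y - S) * set_entry A (X \<inter> S) (Y \<inter> S)"
    using set_entry_mult_disjoint_supports[OF Diff_subset B _ XY, of A] A XY by (simp add: compl)
  then show "set_entry (A * B) X Y = set_entry (B * A) X Y"
    using set_entry_mult_disjoint_supports[OF S A B XY] by simp
qed

subsection \<open>The Heisenberg picture\<close>

definition heisenberg :: "complex mat \<Rightarrow> complex mat \<Rightarrow> complex mat" where
  "heisenberg U A = mat_adjoint U * A * U"

lemma heisenberg_carrier [simp]:
  "U \<in> carrier_mat N N \<Longrightarrow> A \<in> carrier_mat N N \<Longrightarrow> heisenberg U A \<in> carrier_mat N N"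
  by (simp add: heisenberg_def)

lemma heisenberg_mult:
  assumes "U \<in> carrier_mat N N" "V \<in> carrier_mat N N" "A \<in> carrier_mat N N"
  shows "heisenberg (U * V) A = heisenberg V (heisenberg U A)"
  using assms
  by (simp add: heisenberg_def mat_adjoint_mult[of U N N V N] square_mult_assoc[where N = N])

lemma heisenberg_add:
  assumes "U \<in> carrier_mat N N" "A \<in> carrier_mat N N" "B \<in> carrier_mat N N"
  shows "heisenberg U (A + B) = heisenberg U A + heisenberg U B"
  using assms
  by (simp add: heisenberg_def square_mat_distribs[where N = N])

text \<open>An operator commutes with the part of a unitary that acts outside its support, which therefore
  cancels against its adjoint.\<close>

lemma supported_on_heisenberg_light_cone:
  assumes S: "S \<subseteq> {..<m}" and R: "S \<subseteq> R" "R \<subseteq> {..<m}" and A: "supported_on m S A"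
    and W: "supported_on m ({..<m} - S) W" "mat_adjoint W * W = 1\<^sub>m (2 ^ m)"
    and V: "supported_on m R V"
  shows "supported_on m R (heisenberg (W * V) A)"
proof -
  note [simp] = supported_on_carrier[OF A] supported_on_carrier[OF W(1)] supported_on_carrier[OF V]
  have "heisenberg W A = mat_adjoint W * (W * A)"
    using supported_on_mult_commute[OF S A W(1)]
    by (simp add: heisenberg_def square_mult_assoc[where N = "2 ^ m"])
  also have "\<dots> = A"
    by (simp add: W(2) square_mult_one[where N = "2 ^ m"]
        flip: square_mult_assoc[where N = "2 ^ m"])
  finally have "heisenberg (W * V) A = heisenberg V A"
    by (simp add: heisenberg_mult[of _ "2 ^ m"])
  also have "supported_on m R \<dots>"
    unfolding heisenberg_def
    by (intro supported_on_mult supported_on_adjoint supported_on_mono[OF A] V R)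
  finally show ?thesis .
qed

subsection \<open>Degree of an operator\<close>

inductive op_degree_le :: "nat \<Rightarrow> real \<Rightarrow> complex mat \<Rightarrow> bool" for m y where
  supported: "S \<subseteq> {..<m} \<Longrightarrow> real (card S) \<le> y \<Longrightarrow> supported_on m S A \<Longrightarrow> op_degree_le m y A"
| add: "op_degree_le m y A \<Longrightarrow> op_degree_le m y B \<Longrightarrow> op_degree_le m y (A + B)"

lemma op_degree_le_carrier: "op_degree_le m y A \<Longrightarrow> A \<in> operators m"
  by (induction rule: op_degree_le.induct) (simp_all add: supported_on_carrier)

lemma op_degree_le_mono:
  assumes "op_degree_le m y A" "y \<le> y'"
  shows "op_degree_le m y' A"
  using assms
proof induction
  case (supported S A)
  then show ?case by (intro op_degree_le.supported[of S]) simp_all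
qed (blast intro: op_degree_le.add)

lemma op_degree_le_full: "A \<in> operators m \<Longrightarrow> real m \<le> y \<Longrightarrow> op_degree_le m y A"
  by (rule op_degree_le.supported[of "{..<m}"]) (simp_all add: supported_on_lessThan)

lemma op_degree_le_smult: "op_degree_le m y A \<Longrightarrow> op_degree_le m y (c \<cdot>\<^sub>m A)"
proof (induction rule: op_degree_le.induct)
  case (supported S A)
  then show ?case by (intro op_degree_le.supported[of S] supported_on_smult)
next
  case (add A B)
  then show ?case
    by (simp add: square_mat_distribs[where N = "2 ^ m"] op_degree_le_carrier op_degree_le.add)
qed

lemma op_degree_le_mult:
  assumes "op_degree_le m y A" "op_degree_le m z B"
  shows "op_degree_le m (y + z) (A * B)"
  using assms(1)
proof induction
  case (supported S A)
  from assms(2) show ?case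
  proof induction
    case (supported T B)
    have "supported_on m (S \<union> T) (A * B)"
      using \<open>S \<subseteq> {..<m}\<close> \<open>T \<subseteq> {..<m}\<close> \<open>supported_on m S A\<close> \<open>supported_on m T B\<close>
      by (intro supported_on_mult) (auto elim: supported_on_mono)
    moreover have "real (card (S \<union> T)) \<le> y + z"
      using card_Un_le[of S T] \<open>real (card S) \<le> y\<close> \<open>real (card T) \<le> z\<close> by linarith
    ultimately show ?case
      using \<open>S \<subseteq> {..<m}\<close> \<open>T \<subseteq> {..<m}\<close> by (intro op_degree_le.supported[of "S \<union> T"]) auto
  next
    case (add B B')
    then show ?case
      using supported_on_carrier[OF \<open>supported_on m S A\<close>]
      by (simp add: square_mat_distribs[where N = "2 ^ m"] op_degree_le_carrier op_degree_le.add)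
  qed
next
  case (add A A')
  then show ?case
    using op_degree_le_carrier[OF assms(2)]
    by (simp add: square_mat_distribs[where N = "2 ^ m"] op_degree_le_carrier op_degree_le.add)
qed

lemma op_degree_le_heisenberg:
  assumes "op_degree_le m y A" and U: "U \<in> operators m"
    and local: "\<And>S A. S \<subseteq> {..<m} \<Longrightarrow> real (card S) \<le> y \<Longrightarrow> supported_on m S A \<Longrightarrow>
      op_degree_le m z (heisenberg U A)"
  shows "op_degree_le m z (heisenberg U A)"
  using assms(1)
proof induction
  case (add A B)
  then show ?case
    by (simp add: heisenberg_add[OF U] op_degree_le_carrier op_degree_le.add)
qed (rule local)

subsection \<open>Layers of single-qubit unitaries\<close>

lemma single_qubit_layer_carrier [simp]: "single_qubit_layer m u \<in> operators m"
  by (simp add: single_qubit_layer_def)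

lemma set_entry_single_qubit_layer:
  "X \<subseteq> {..<m} \<Longrightarrow> Y \<subseteq> {..<m} \<Longrightarrow> set_entry (single_qubit_layer m u) X Y =
    (\<Prod>k<m. u k $$ (of_bool (k \<in> X), of_bool (k \<in> Y)))"
  by (simp add: single_qubit_layer_def set_entry_mat qbit_set_encode of_bool_def)

lemma sum_Pow_prod:
  fixes g :: "'a \<Rightarrow> bool \<Rightarrow> 'b :: comm_semiring_1"
  assumes "finite T"
  shows "(\<Sum>Z\<in>Pow T. \<Prod>k\<in>T. g k (k \<in> Z)) = (\<Prod>k\<in>T. \<Sum>b\<in>UNIV. g k b)"
proof -
  have "(\<Prod>k\<in>T. g k (k \<in> Z)) = (\<Prod>k\<in>Z. g k True) * (\<Prod>k\<in>T - Z. g k False)" if "Z \<in> Pow T" for Z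
    using that prod.subset_diff[of Z T "\<lambda>k. g k (k \<in> Z)"] assms by (simp add: mult.commute)
  then have "(\<Sum>Z\<in>Pow T. \<Prod>k\<in>T. g k (k \<in> Z)) = (\<Prod>k\<in>T. g k True + g k False)"
    unfolding prod_add[OF assms] by (rule sum.cong[OF refl])
  then show ?thesis by (simp add: UNIV_bool add.commute)
qed

lemma single_qubit_layer_mult:
  assumes "\<And>k. k < m \<Longrightarrow> u k \<in> carrier_mat 2 2" "\<And>k. k < m \<Longrightarrow> v k \<in> carrier_mat 2 2"
  shows "single_qubit_layer m u * single_qubit_layer m v = single_qubit_layer m (\<lambda>k. u k * v k)"
proof (rule operators_eqI)
  fix X Y assume XY: "X \<subseteq> {..<m}" "Y \<subseteq> {..<m}"
  have "set_entry (single_qubit_layer m u * single_qubit_layer m v) X Y =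
    (\<Sum>Z\<in>Pow {..<m}. \<Prod>k<m. u k $$ (of_bool (k \<in> X), of_bool (k \<in> Z)) *
      v k $$ (of_bool (k \<in> Z), of_bool (k \<in> Y)))"
    using XY by (simp add: set_entry_mult[of _ m] set_entry_single_qubit_layer prod.distrib)
  also have "\<dots> = (\<Prod>k<m. \<Sum>b\<in>UNIV. u k $$ (of_bool (k \<in> X), of_bool b) *
      v k $$ (of_bool b, of_bool (k \<in> Y)))"
    by (rule sum_Pow_prod[of _ "\<lambda>k b. u k $$ (of_bool (k \<in> X), of_bool b) *
      v k $$ (of_bool b, of_bool (k \<in> Y))"]) simp
  also have "\<dots> = (\<Prod>k<m. (u k * v k) $$ (of_bool (k \<in> X), of_bool (k \<in> Y)))"
  proof (rule prod.cong[OF refl])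
    fix k assume "k \<in> {..<m}"
    then have "dim_row (u k) = 2" "dim_col (u k) = 2" "dim_row (v k) = 2" "dim_col (v k) = 2"
      using assms by auto
    then show "(\<Sum>b\<in>UNIV. u k $$ (of_bool (k \<in> X), of_bool b) *
        v k $$ (of_bool b, of_bool (k \<in> Y))) =
        (u k * v k) $$ (of_bool (k \<in> X), of_bool (k \<in> Y))"
      by (simp add: scalar_prod_def UNIV_bool numeral_2_eq_2 of_bool_def)
  qed
  also have "\<dots> = set_entry (single_qubit_layer m (\<lambda>k. u k * v k)) X Y"
    using XY by (simp add: set_entry_single_qubit_layer)
  finally show "set_entry (single_qubit_layer m u * single_qubit_layer m v) X Y = \<dots>" .
qed simp_all

lemma single_qubit_layer_adjoint:
  assumes "\<And>k. k < m \<Longrightarrow> u k \<in> carrier_mat 2 2"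
  shows "mat_adjoint (single_qubit_layer m u) = single_qubit_layer m (\<lambda>k. mat_adjoint (u k))"
proof (rule operators_eqI)
  fix X Y :: "nat set" assume XY: "X \<subseteq> {..<m}" "Y \<subseteq> {..<m}"
  have "dim_row (u k) = 2" "dim_col (u k) = 2" if "k < m" for k
    using assms[OF that] by auto
  with XY show "set_entry (mat_adjoint (single_qubit_layer m u)) X Y =
      set_entry (single_qubit_layer m (\<lambda>k. mat_adjoint (u k))) X Y"
    by (simp add: set_entry_adjoint[of _ m] set_entry_single_qubit_layer cnj_prod)
qed simp_all

lemma single_qubit_layer_one: "single_qubit_layer m (\<lambda>_. 1\<^sub>m 2) = 1\<^sub>m (2 ^ m)"
proof (rule operators_eqI)
  fix X Y :: "nat set" assume XY: "X \<subseteq> {..<m}" "Y \<subseteq> {..<m}"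
  have "set_entry (single_qubit_layer m (\<lambda>_. 1\<^sub>m 2)) X Y = (\<Prod>k<m. of_bool (k \<in> X \<longleftrightarrow> k \<in> Y))"
    using XY by (auto simp: set_entry_single_qubit_layer intro!: prod.cong)
  also have "\<dots> = of_bool (\<forall>k<m. k \<in> X \<longleftrightarrow> k \<in> Y)"
    by (auto intro!: prod.neutral)
  also have "(\<forall>k<m. k \<in> X \<longleftrightarrow> k \<in> Y) \<longleftrightarrow> X = Y" using XY by blast
  finally show "set_entry (single_qubit_layer m (\<lambda>_. 1\<^sub>m 2)) X Y = set_entry (1\<^sub>m (2 ^ m)) X Y"
    using XY by (simp add: set_entry_one)
qed simp_all

lemma single_qubit_layer_cong:
  "(\<And>k. k < m \<Longrightarrow> u k = v k) \<Longrightarrow> single_qubit_layer m u = single_qubit_layer m v"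
  unfolding single_qubit_layer_def by (intro arg_cong[where f = "mat _ _"] ext) auto

lemma unitary_single_qubit_layer:
  assumes "\<And>k. k < m \<Longrightarrow> unitary_mat 2 (u k)"
  shows "unitary_mat (2 ^ m) (single_qubit_layer m u)"
proof -
  note u = assms[unfolded unitary_mat_def]
  have "single_qubit_layer m (\<lambda>k. mat_adjoint (u k) * u k) = 1\<^sub>m (2 ^ m)"
    "single_qubit_layer m (\<lambda>k. u k * mat_adjoint (u k)) = 1\<^sub>m (2 ^ m)"
    using u by (simp_all add: single_qubit_layer_cong[where v = "\<lambda>_. 1\<^sub>m 2"] single_qubit_layer_one)
  with u show ?thesis
    by (simp add: unitary_mat_def single_qubit_layer_adjoint single_qubit_layer_mult)
qed

lemma supported_on_single_qubit_layer:
  assumes S: "S \<subseteq> {..<m}" and u: "\<And>k. k < m \<Longrightarrow> k \<notin> S \<Longrightarrow> u k = 1\<^sub>m 2"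
  shows "supported_on m S (single_qubit_layer m u)"
proof (rule supported_onI)
  fix X Y :: "nat set"
  assume XY: "X \<subseteq> {..<m}" "Y \<subseteq> {..<m}"
  have entry: "set_entry (single_qubit_layer m u) X Y =
      (\<Prod>k\<in>S. u k $$ (of_bool (k \<in> X), of_bool (k \<in> Y))) * of_bool (X - S = Y - S)"
    if "X \<subseteq> {..<m}" "Y \<subseteq> {..<m}" for X Y
  proof -
    have "(\<Prod>k\<in>{..<m} - S. u k $$ (of_bool (k \<in> X), of_bool (k \<in> Y))) =
        (\<Prod>k\<in>{..<m} - S. of_bool (k \<in> X \<longleftrightarrow> k \<in> Y))"
      by (auto simp: u intro!: prod.cong)
    also have "\<dots> = of_bool (\<forall>k\<in>{..<m} - S. k \<in> X \<longleftrightarrow> k \<in> Y)"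
      by (auto intro!: prod.neutral)
    also have "(\<forall>k\<in>{..<m} - S. k \<in> X \<longleftrightarrow> k \<in> Y) \<longleftrightarrow> X - S = Y - S"
      using that by blast
    finally show ?thesis
      using that prod.subset_diff[OF S, of "\<lambda>k. u k $$ (of_bool (k \<in> X), of_bool (k \<in> Y))"]
      by (simp add: set_entry_single_qubit_layer)
  qed
  have "X \<inter> S - S = Y \<inter> S - S" "X \<inter> S \<subseteq> {..<m}" "Y \<inter> S \<subseteq> {..<m}" using XY by auto
  then show "set_entry (single_qubit_layer m u) X Y =
      (if X - S = Y - S then set_entry (single_qubit_layer m u) (X \<inter> S) (Y \<inter> S) else 0)"
    using XY by (simp add: entry)
qed simp

lemma is_single_qubit_layer_unitary: "is_single_qubit_layer m L \<Longrightarrow> unitary_mat (2 ^ m) L"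
  by (auto simp: is_single_qubit_layer_def intro: unitary_single_qubit_layer)

lemma is_single_qubit_layer_carrier: "is_single_qubit_layer m L \<Longrightarrow> L \<in> operators m"
  using is_single_qubit_layer_unitary by (simp add: unitary_mat_def)

lemma op_degree_le_heisenberg_single_qubit_layer:
  assumes A: "op_degree_le m y A" and L: "is_single_qubit_layer m L"
  shows "op_degree_le m y (heisenberg L A)"
proof (rule op_degree_le_heisenberg[OF A is_single_qubit_layer_carrier[OF L]])
  obtain u where u: "\<And>k. k < m \<Longrightarrow> unitary_mat 2 (u k)" and L_def: "L = single_qubit_layer m u"
    using L unfolding is_single_qubit_layer_def by blast
  fix S A assume S: "S \<subseteq> {..<m}" "real (card S) \<le> y" "supported_on m S A"
  let ?v = "\<lambda>k. if k \<in> S then u k else 1\<^sub>m 2" and ?w = "\<lambda>k. if k \<in> S then 1\<^sub>m 2 else u k"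
  have carrier: "u k \<in> carrier_mat 2 2" if "k < m" for k
    using u[OF that] by (simp add: unitary_mat_def)
  have "unitary_mat 2 (?w k)" if "k < m" for k
    using u[OF that] by (auto simp: unitary_mat_def intro!: eq_matI)
  then have w: "mat_adjoint (single_qubit_layer m ?w) * single_qubit_layer m ?w = 1\<^sub>m (2 ^ m)"
    using unitary_single_qubit_layer[of m ?w] by (simp add: unitary_mat_def)
  have "single_qubit_layer m ?w * single_qubit_layer m ?v = single_qubit_layer m u"
    using carrier
    by (auto simp: single_qubit_layer_mult square_mult_one[where N = 2]
        intro!: single_qubit_layer_cong)
  moreover have "supported_on m ({..<m} - S) (single_qubit_layer m ?w)"
    "supported_on m S (single_qubit_layer m ?v)"
    using S(1) by (auto intro: supported_on_single_qubit_layer)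
  ultimately have "supported_on m S (heisenberg L A)"
    unfolding L_def using supported_on_heisenberg_light_cone[OF S(1) order_refl S(1,3) _ w] by metis
  with S show "op_degree_le m y (heisenberg L A)"
    by (intro op_degree_le.supported)
qed

subsection \<open>Diagonal operators\<close>

definition diag_op :: "nat \<Rightarrow> (nat set \<Rightarrow> real) \<Rightarrow> complex mat" where
  "diag_op m h = mat (2 ^ m) (2 ^ m)
     (\<lambda>(i, j). if i = j then complex_of_real (h (set_decode i)) else 0)"

lemma diag_op_carrier [simp]: "diag_op m h \<in> operators m"
  by (simp add: diag_op_def)

lemma set_entry_diag_op:
  "X \<subseteq> {..<m} \<Longrightarrow> Y \<subseteq> {..<m} \<Longrightarrow>
    set_entry (diag_op m h) X Y = (if X = Y then complex_of_real (h X) else 0)"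
  by (simp add: diag_op_def set_entry_mat set_encode_eq_iff finite_subset)

lemma set_entry_diag_op_mult:
  assumes "A \<in> operators m" "X \<subseteq> {..<m}" "Y \<subseteq> {..<m}"
  shows "set_entry (diag_op m h * A) X Y = complex_of_real (h X) * set_entry A X Y"
proof -
  have "set_entry (diag_op m h * A) X Y =
      (\<Sum>Z\<in>Pow {..<m}. if X = Z then complex_of_real (h X) * set_entry A Z Y else 0)"
    unfolding set_entry_mult[OF diag_op_carrier assms]
    using assms by (intro sum.cong refl) (simp add: set_entry_diag_op)
  then show ?thesis using assms by (simp add: sum.delta')
qed

lemma diag_op_adjoint [simp]: "mat_adjoint (diag_op m h) = diag_op m h"
  by (rule operators_eqI[of _ m]) (auto simp: set_entry_adjoint[of _ m] set_entry_diag_op)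

lemma diag_op_one: "diag_op m (\<lambda>_. 1) = 1\<^sub>m (2 ^ m)"
  by (rule operators_eqI[of _ m]) (simp_all add: set_entry_one set_entry_diag_op)

lemma diag_op_mult: "diag_op m h * diag_op m g = diag_op m (\<lambda>X. h X * g X)"
  by (rule operators_eqI[of _ m]) (auto simp: set_entry_diag_op_mult[of _ m] set_entry_diag_op)

lemma diag_op_add: "diag_op m h + diag_op m g = diag_op m (\<lambda>X. h X + g X)"
  by (rule operators_eqI[of _ m]) (auto simp: set_entry_add[of _ m] set_entry_diag_op)

lemma diag_op_diff: "diag_op m h - diag_op m g = diag_op m (\<lambda>X. h X - g X)"
  by (rule eq_matI) (simp_all add: diag_op_def)

lemma diag_op_smult: "complex_of_real c \<cdot>\<^sub>m diag_op m h = diag_op m (\<lambda>X. c * h X)"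
  by (rule operators_eqI[of _ m]) (auto simp: set_entry_smult[of _ m] set_entry_diag_op)

lemma supported_on_diag_op:
  assumes h: "\<And>X. X \<subseteq> {..<m} \<Longrightarrow> h X = h (X \<inter> S)"
  shows "supported_on m S (diag_op m h)"
proof (rule supported_onI)
  fix X Y :: "nat set"
  assume XY: "X \<subseteq> {..<m}" "Y \<subseteq> {..<m}"
  moreover from XY have "X \<inter> S \<subseteq> {..<m}" "Y \<inter> S \<subseteq> {..<m}" by auto
  moreover have "X = Y \<longleftrightarrow> X - S = Y - S \<and> X \<inter> S = Y \<inter> S" by blast
  ultimately show "set_entry (diag_op m h) X Y =
      (if X - S = Y - S then set_entry (diag_op m h) (X \<inter> S) (Y \<inter> S) else 0)"
    using h[OF XY(1)] by (simp add: set_entry_diag_op)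
qed simp

lemma op_degree_le_diag_const: "0 \<le> t \<Longrightarrow> op_degree_le m t (diag_op m (\<lambda>_. c))"
  by (rule op_degree_le.supported[of "{}"]) (auto intro: supported_on_diag_op)

lemma op_degree_le_diag_indicator: "k < m \<Longrightarrow> op_degree_le m 1 (diag_op m (\<lambda>X. of_bool (k \<in> X)))"
  by (rule op_degree_le.supported[of "{k}"]) (auto intro: supported_on_diag_op)

lemma op_degree_le_diag_add:
  "op_degree_le m t (diag_op m h) \<Longrightarrow> op_degree_le m t (diag_op m g) \<Longrightarrow>
    op_degree_le m t (diag_op m (\<lambda>X. h X + g X))"
  using op_degree_le.add by (fastforce simp: diag_op_add)

lemma op_degree_le_diag_cmult:
  "op_degree_le m t (diag_op m h) \<Longrightarrow> op_degree_le m t (diag_op m (\<lambda>X. c * h X))"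
  using op_degree_le_smult by (fastforce simp flip: diag_op_smult)

lemma op_degree_le_diag_mult:
  "op_degree_le m s (diag_op m h) \<Longrightarrow> op_degree_le m t (diag_op m g) \<Longrightarrow>
    op_degree_le m (s + t) (diag_op m (\<lambda>X. h X * g X))"
  using op_degree_le_mult by (fastforce simp flip: diag_op_mult)

lemma op_degree_le_diag_sum:
  assumes "finite I" "0 \<le> t" "\<And>i. i \<in> I \<Longrightarrow> op_degree_le m t (diag_op m (h i))"
  shows "op_degree_le m t (diag_op m (\<lambda>X. \<Sum>i\<in>I. h i X))"
  using assms(1,3)
proof (induction I)
  case empty
  then show ?case using op_degree_le_diag_const[OF assms(2)] by simp
next
  case (insert i I)
  then show ?case by (simp add: op_degree_le_diag_add)
qed

lemma op_degree_le_diag_prod: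
  assumes "finite I" "\<And>i. i \<in> I \<Longrightarrow> op_degree_le m (t i) (diag_op m (h i))"
  shows "op_degree_le m (\<Sum>i\<in>I. t i) (diag_op m (\<lambda>X. \<Prod>i\<in>I. h i X))"
  using assms
proof (induction I)
  case empty
  then show ?case using op_degree_le_diag_const[of 0] by simp
next
  case (insert i I)
  then show ?case by (simp add: op_degree_le_diag_mult)
qed

lemma op_degree_le_diag_power:
  assumes "op_degree_le m t (diag_op m h)"
  shows "op_degree_le m (real l * t) (diag_op m (\<lambda>X. h X ^ l))"
  using op_degree_le_diag_prod[of "{..<l}" m "\<lambda>_. t" "\<lambda>_. h"] assms by simp

lemma op_degree_le_diag_poly:
  assumes h: "op_degree_le m t (diag_op m h)" and "0 \<le> t"
  shows "op_degree_le m (real (degree p) * t) (diag_op m (\<lambda>X. poly p (h X)))"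
  unfolding poly_altdef
proof (intro op_degree_le_diag_sum op_degree_le_diag_cmult)
  fix i assume "i \<in> {..degree p}"
  then have "real i * t \<le> real (degree p) * t" using \<open>0 \<le> t\<close> by (simp add: mult_right_mono)
  then show "op_degree_le m (real (degree p) * t) (diag_op m (\<lambda>X. h X ^ i))"
    using op_degree_le_mono[OF op_degree_le_diag_power[OF h]] by blast
qed (use \<open>0 \<le> t\<close> in auto)

subsection \<open>Chebyshev polynomials\<close>

fun cheb_poly :: "nat \<Rightarrow> real poly" where
  "cheb_poly 0 = 1"
| "cheb_poly (Suc 0) = [:0, 1:]"
| "cheb_poly (Suc (Suc k)) = [:0, 2:] * cheb_poly (Suc k) - cheb_poly k"

lemma degree_cheb_poly_le: "degree (cheb_poly k) \<le> k"
proof (induction k rule: cheb_poly.induct)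
  case (3 k)
  have "degree ([:0, 2:] * cheb_poly (Suc k)) \<le>
      degree [:0, 2 :: real:] + degree (cheb_poly (Suc k))"
    by (rule degree_mult_le)
  with 3 show ?case by (auto intro!: degree_diff_le)
qed simp_all

lemma cheb_poly_cos: "poly (cheb_poly k) (cos t) = cos (real k * t)"
proof (induction k rule: cheb_poly.induct)
  case (3 k)
  have "cos ((real k + 1) * t + t) + cos ((real k + 1) * t - t) =
      2 * cos ((real k + 1) * t) * cos t"
    by (simp only: cos_add cos_diff)
  moreover have "(real k + 1) * t + t = real (Suc (Suc k)) * t" "(real k + 1) * t - t = real k * t"
    by (simp_all add: algebra_simps)
  ultimately show ?case using 3 by (simp add: algebra_simps)
qed simp_all

lemma abs_cheb_poly_le_1: "\<bar>x\<bar> \<le> 1 \<Longrightarrow> \<bar>poly (cheb_poly k) x\<bar> \<le> 1"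
  using cheb_poly_cos[of k "arccos x"] by (simp add: cos_arccos_abs)

lemma cheb_poly_ge:
  assumes "0 \<le> \<mu>"
  shows "poly (cheb_poly k) (1 + \<mu>) \<ge> 1 + (real k)\<^sup>2 * \<mu>"
proof -
  let ?c = "\<lambda>k. poly (cheb_poly k) (1 + \<mu>)"
  have "?c k \<ge> 1 + (real k)\<^sup>2 * \<mu> \<and> ?c (Suc k) - ?c k \<ge> (2 * real k + 1) * \<mu>"
  proof (induction k)
    case (Suc k)
    then have lower: "?c (Suc k) \<ge> 1 + (real (Suc k))\<^sup>2 * \<mu>"
      by (simp add: power2_eq_square algebra_simps)
    have "0 \<le> (real (Suc k))\<^sup>2 * \<mu>" using assms by simp
    with lower have "?c (Suc k) \<ge> 1" by linarith
    then have "\<mu> * ?c (Suc k) \<ge> \<mu> * 1" using assms by (intro mult_left_mono)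
    with Suc lower show ?case by (simp add: algebra_simps)
  qed simp
  then show ?thesis ..
qed

lemma cheb_poly_ge_2:
  assumes "s \<ge> 2" "sqrt s \<le> real k"
  shows "poly (cheb_poly k) (1 + 1 / (s - 1)) \<ge> 2"
proof -
  have "s \<le> (real k)\<^sup>2" using assms(2) by (rule sqrt_le_D)
  then have "s * (1 / (s - 1)) \<le> (real k)\<^sup>2 * (1 / (s - 1))"
    using assms(1) by (intro mult_right_mono) auto
  moreover have "s * (1 / (s - 1)) \<ge> 1" using assms(1) by (simp add: field_simps)
  moreover have "poly (cheb_poly k) (1 + 1 / (s - 1)) \<ge> 1 + (real k)\<^sup>2 * (1 / (s - 1))"
    using assms(1) by (intro cheb_poly_ge) simp
  ultimately show ?thesis by linarith
qed

lemma point_indicator_poly: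
  fixes s l :: nat
  assumes "s \<ge> 2"
  obtains p :: "real poly" where "real (degree p) \<le> 4 * real l * sqrt s" "poly p s = 1"
    and "\<And>x. 0 \<le> x \<Longrightarrow> x \<le> real s - 1 \<Longrightarrow> 0 \<le> poly p x \<and> poly p x \<le> 1 / 4 ^ l"
proof -
  define \<mu> where "\<mu> = 1 / (real s - 1)"
  define k where "k = nat \<lceil>sqrt s\<rceil>"
  define c where "c = poly (cheb_poly k) (1 + \<mu>)"
  define p where "p = (smult (1 / c) (pcompose (cheb_poly k) [:0, \<mu>:])) ^ (2 * l)"
  have "sqrt s \<ge> 1" using assms by simp
  then have k: "sqrt s \<le> k" "real k \<le> 2 * sqrt s" unfolding k_def by linarith+
  have c: "c \<ge> 2" using cheb_poly_ge_2[of "real s" k] k(1) assms by (simp add: c_def \<mu>_def)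
  have poly_p: "poly p x = (poly (cheb_poly k) (x * \<mu>) / c) ^ (2 * l)" for x
    by (simp add: p_def poly_pcompose)
  show ?thesis
  proof
    have "degree (smult (1 / c) (pcompose (cheb_poly k) [:0, \<mu>:])) \<le>
        degree (cheb_poly k) * degree [:0, \<mu>:]"
      by (metis degree_pcompose degree_smult_le)
    also have "\<dots> \<le> k * 1" by (intro mult_le_mono degree_cheb_poly_le) simp
    finally have "degree p \<le> k * (2 * l)"
      unfolding p_def by (intro degree_power_le[THEN le_trans] mult_le_mono1) simp
    then have "real (degree p) \<le> real k * (2 * real l)"
      by (metis of_nat_le_iff of_nat_mult of_nat_numeral)
    also have "\<dots> \<le> 2 * sqrt s * (2 * real l)" using k(2) by (rule mult_right_mono) simp
    finally show "real (degree p) \<le> 4 * real l * sqrt s" by (simp add: ac_simps)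
    have "real s * \<mu> = 1 + \<mu>" using assms by (simp add: \<mu>_def field_simps)
    then show "poly p s = 1" using c by (simp add: poly_p c_def)
  next
    fix x :: real
    assume x: "0 \<le> x" "x \<le> real s - 1"
    then have "\<bar>x * \<mu>\<bar> \<le> 1" using assms by (simp add: \<mu>_def)
    then have "\<bar>poly (cheb_poly k) (x * \<mu>) / c\<bar> \<le> 1 / 2"
      using c abs_cheb_poly_le_1[of "x * \<mu>" k] frac_le[of 1 _ 2 c] by (simp add: abs_divide)
    then have "\<bar>poly (cheb_poly k) (x * \<mu>) / c\<bar> ^ (2 * l) \<le> (1 / 2) ^ (2 * l)"
      by (intro power_mono) auto
    then show "0 \<le> poly p x \<and> poly p x \<le> 1 / 4 ^ l"
      by (simp add: poly_p power_mult power_divide)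
  qed
qed

subsection \<open>Approximation of a multi-qubit CZ gate\<close>

definition cz_sign :: "nat set \<Rightarrow> nat set \<Rightarrow> real" where
  "cz_sign T X = (if T \<subseteq> X then - 1 else 1)"

lemma abs_cz_sign [simp]: "\<bar>cz_sign T X\<bar> = 1"
  by (simp add: cz_sign_def)

lemma abs_prod_le_1:
  fixes f :: "'a \<Rightarrow> real"
  assumes "\<And>i. i \<in> I \<Longrightarrow> \<bar>f i\<bar> \<le> 1"
  shows "\<bar>\<Prod>i\<in>I. f i\<bar> \<le> 1"
  unfolding abs_prod using assms by (intro prod_le_1) auto

lemma op_degree_le_diag_weight:
  assumes "T \<subseteq> {..<m}"
  shows "op_degree_le m 1 (diag_op m (\<lambda>X. real (card (T \<inter> X))))"
proof -
  have "finite T" using assms finite_subset by blast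
  then have "op_degree_le m 1 (diag_op m (\<lambda>X. \<Sum>i\<in>T. of_bool (i \<in> X)))"
    using assms by (intro op_degree_le_diag_sum op_degree_le_diag_indicator) auto
  then show ?thesis using \<open>finite T\<close> by (simp add: sum_of_bool_eq)
qed

lemma subset_indicator_approx:
  assumes T: "T \<subseteq> {..<m}" "card T \<ge> 2"
  obtains b where "op_degree_le m (4 * real l * sqrt (card T)) (diag_op m b)"
    and "\<And>X. T \<subseteq> X \<Longrightarrow> b X = 1" and "\<And>X. \<not> T \<subseteq> X \<Longrightarrow> 0 \<le> b X \<and> b X \<le> 1 / 4 ^ l"
proof -
  obtain p :: "real poly" where p: "real (degree p) \<le> 4 * real l * sqrt (card T)"
    "poly p (card T) = 1"
    "\<And>x. 0 \<le> x \<Longrightarrow> x \<le> real (card T) - 1 \<Longrightarrow> 0 \<le> poly p x \<and> poly p x \<le> 1 / 4 ^ l"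
    using point_indicator_poly[OF T(2)] by metis
  show ?thesis
  proof
    show "op_degree_le m (4 * real l * sqrt (card T)) (diag_op m (\<lambda>X. poly p (card (T \<inter> X))))"
      using op_degree_le_diag_poly[OF op_degree_le_diag_weight[OF T(1)], of p] p(1)
      by (auto intro: op_degree_le_mono)
    show "poly p (card (T \<inter> X)) = 1" if "T \<subseteq> X" for X
      using that p(2) by (simp add: Int_absorb2)
    show "0 \<le> poly p (card (T \<inter> X)) \<and> poly p (card (T \<inter> X)) \<le> 1 / 4 ^ l" if "\<not> T \<subseteq> X" for X
    proof -
      have "card (T \<inter> X) < card T"
        using that T(1) finite_subset by (intro psubset_card_mono) auto
      then show ?thesis by (intro p(3)) auto
    qed
  qed
qed

lemma cz_sign_approx:
  assumes "T \<subseteq> {..<m}" "card T \<ge> 2"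
  obtains h where "op_degree_le m (4 * real l * sqrt (card T)) (diag_op m h)"
    and "\<And>X. \<bar>h X\<bar> \<le> 1" and "\<And>X. \<bar>h X - cz_sign T X\<bar> \<le> 2 / 4 ^ l"
proof -
  obtain b where b: "op_degree_le m (4 * real l * sqrt (card T)) (diag_op m b)"
    "\<And>X. T \<subseteq> X \<Longrightarrow> b X = 1" "\<And>X. \<not> T \<subseteq> X \<Longrightarrow> 0 \<le> b X \<and> b X \<le> 1 / 4 ^ l"
    using subset_indicator_approx[OF assms] by metis
  have "(1 :: real) / 4 ^ l \<le> 1" by simp
  then have b_unit: "0 \<le> b X \<and> b X \<le> 1" for X
    using b(2)[of X] b(3)[of X] order_trans[of "b X" "1 / 4 ^ l" 1] by (cases "T \<subseteq> X") simp_all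
  show ?thesis
  proof
    show "op_degree_le m (4 * real l * sqrt (card T)) (diag_op m (\<lambda>X. 1 + (- 2) * b X))"
      by (intro op_degree_le_diag_add op_degree_le_diag_cmult op_degree_le_diag_const b(1)) simp
    show "\<bar>1 + (- 2) * b X\<bar> \<le> 1" for X using b_unit[of X] by (simp add: abs_le_iff)
    show "\<bar>1 + (- 2) * b X - cz_sign T X\<bar> \<le> 2 / 4 ^ l" for X
    proof (cases "T \<subseteq> X")
      case False
      with b(3)[of X] have "0 \<le> b X" "2 * b X \<le> 2 / 4 ^ l" by simp_all
      with False show ?thesis by (simp add: cz_sign_def)
    qed (simp add: b(2) cz_sign_def)
  qed
qed

subsection \<open>Approximation of a layer of CZ gates\<close>

definition cz_signs :: "nat set set \<Rightarrow> nat set \<Rightarrow> real" where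
  "cz_signs F X = (\<Prod>T\<in>F. cz_sign T X)"

lemma abs_cz_signs [simp]: "\<bar>cz_signs F X\<bar> = 1"
  by (simp add: cz_signs_def abs_prod)

lemma cz_signs_partition:
  assumes "finite F"
  shows "cz_signs F = (\<lambda>X. cz_signs {T \<in> F. P T} X * cz_signs {T \<in> F. \<not> P T} X)"
proof
  have "{T \<in> F. P T} \<union> {T \<in> F. \<not> P T} = F" by blast
  moreover have "cz_signs ({T \<in> F. P T} \<union> {T \<in> F. \<not> P T}) X =
      cz_signs {T \<in> F. P T} X * cz_signs {T \<in> F. \<not> P T} X" for X
    unfolding cz_signs_def using assms by (intro prod.union_disjoint) auto
  ultimately show "cz_signs F X = cz_signs {T \<in> F. P T} X * cz_signs {T \<in> F. \<not> P T} X" for X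
    by (simp only:)
qed

lemma cz_signs_Int: "\<Union>F \<subseteq> S \<Longrightarrow> cz_signs F (X \<inter> S) = cz_signs F X"
  unfolding cz_signs_def by (intro prod.cong) (auto simp: cz_sign_def)

lemma cz_layer_eq_diag_op: "cz_layer m F = diag_op m (cz_signs F)"
  unfolding cz_layer_def diag_op_def cz_signs_def cz_sign_def
  by (intro arg_cong[where f = "mat _ _"] ext)
    (auto simp: qbit_iff_set_decode subset_iff of_real_prod intro!: prod.cong)

lemma sum_card_disjoint_le:
  assumes "finite M" "disjoint F" "\<Union>F \<subseteq> M"
  shows "(\<Sum>T\<in>F. card T) \<le> card M"
proof -
  have "(\<Sum>T\<in>F. card T) = card (\<Union>F)"
    using assms by (intro card_Union_disjoint[symmetric]) (auto intro: finite_subset)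
  also have "\<dots> \<le> card M" using assms by (intro card_mono)
  finally show ?thesis .
qed

lemma card_Un_meeting_le:
  fixes D :: real
  assumes S: "finite S" and F: "disjoint F" and D: "1 \<le> D" "\<And>T. T \<in> F \<Longrightarrow> real (card T) \<le> D"
  shows "real (card (S \<union> \<Union>{T \<in> F. T \<inter> S \<noteq> {}})) \<le> real (card S) * D"
proof -
  define B where "B s = insert s (\<Union>{T \<in> F. s \<in> T})" for s
  have B: "real (card (B s)) \<le> D" for s
  proof (cases "\<exists>T\<in>F. s \<in> T")
    case True
    then obtain T where T: "T \<in> F" "s \<in> T" by blast
    then have "{T \<in> F. s \<in> T} = {T}" using disjointD[OF F] by blast
    then show ?thesis using T D(2)[OF T(1)] by (simp add: B_def insert_absorb)
  next
    case False
    then have "{T \<in> F. s \<in> T} = {}" by blast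
    then show ?thesis using D(1) by (simp only: B_def Union_empty) simp
  qed
  have "S \<union> \<Union>{T \<in> F. T \<inter> S \<noteq> {}} = (\<Union>s\<in>S. B s)" unfolding B_def by blast
  then have "real (card (S \<union> \<Union>{T \<in> F. T \<inter> S \<noteq> {}})) \<le> real (\<Sum>s\<in>S. card (B s))"
    using card_UN_le[OF S, of B] by (simp only: of_nat_le_iff)
  also have "\<dots> \<le> (\<Sum>s\<in>S. D)" unfolding of_nat_sum by (intro sum_mono B)
  finally show ?thesis by simp
qed

lemma op_degree_le_heisenberg_small_cz:
  assumes A: "op_degree_le m y A" and F: "\<Union>F \<subseteq> {..<m}" "disjoint F"
    and D: "1 \<le> D" "\<And>T. T \<in> F \<Longrightarrow> real (card T) \<le> D"
  shows "op_degree_le m (y * D) (heisenberg (diag_op m (cz_signs F)) A)"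
proof (rule op_degree_le_heisenberg[OF A])
  fix S A assume S: "S \<subseteq> {..<m}" "real (card S) \<le> y" "supported_on m S A"
  define Near where "Near = {T \<in> F. T \<inter> S \<noteq> {}}"
  define Far where "Far = {T \<in> F. T \<inter> S = {}}"
  define R where "R = S \<union> \<Union>Near"
  have "finite F" using F(1) finite_subset by (blast intro: finite_UnionD)
  have split: "diag_op m (cz_signs F) = diag_op m (cz_signs Far) * diag_op m (cz_signs Near)"
    unfolding cz_signs_partition[of F "\<lambda>T. T \<inter> S = {}", OF \<open>finite F\<close>]
      Near_def Far_def diag_op_mult ..
  have "cz_signs Far X * cz_signs Far X = 1" for X
    using abs_mult_self_eq[of "cz_signs Far X"] by simp
  then have "mat_adjoint (diag_op m (cz_signs Far)) * diag_op m (cz_signs Far) = 1\<^sub>m (2 ^ m)"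
    by (simp add: diag_op_mult diag_op_one)
  moreover have "supported_on m ({..<m} - S) (diag_op m (cz_signs Far))"
    using F(1) by (intro supported_on_diag_op cz_signs_Int[symmetric]) (auto simp: Far_def)
  moreover have "supported_on m R (diag_op m (cz_signs Near))"
    by (intro supported_on_diag_op cz_signs_Int[symmetric]) (auto simp: R_def)
  moreover have R: "S \<subseteq> R" "R \<subseteq> {..<m}"
    using S(1) F(1) by (auto simp: R_def Near_def)
  ultimately have "supported_on m R (heisenberg (diag_op m (cz_signs F)) A)"
    unfolding split using S by (intro supported_on_heisenberg_light_cone)
  moreover have "real (card R) \<le> y * D"
  proof -
    have "finite S" using S(1) finite_subset by blast
    then have "real (card R) \<le> real (card S) * D"
      unfolding R_def Near_def by (rule card_Un_meeting_le[OF _ F(2) D])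
    also have "\<dots> \<le> y * D" using S(2) D(1) by (intro mult_right_mono) auto
    finally show ?thesis .
  qed
  ultimately show "op_degree_le m (y * D) (heisenberg (diag_op m (cz_signs F)) A)"
    using R(2) by (intro op_degree_le.supported)
qed simp

lemma sum_sqrt_card_le:
  fixes D :: real
  assumes "1 \<le> D" and large: "\<And>T. T \<in> F \<Longrightarrow> D < real (card T)"
  shows "(\<Sum>T\<in>F. sqrt (card T)) \<le> real (\<Sum>T\<in>F. card T) / sqrt D"
proof -
  have "sqrt (card T) \<le> real (card T) / sqrt D" if "T \<in> F" for T
  proof -
    have "sqrt D \<le> sqrt (card T)" using large[OF that] by simp
    then have "sqrt D * sqrt (card T) \<le> sqrt (card T) * sqrt (card T)"
      by (intro mult_right_mono) auto
    then show ?thesis using \<open>1 \<le> D\<close> by (simp add: field_simps)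
  qed
  then show ?thesis by (simp add: sum_divide_distrib sum_mono)
qed

lemma norm_prod_diff_le_card:
  fixes f g :: "'i \<Rightarrow> 'a :: {real_normed_algebra_1, comm_monoid_mult}"
  assumes "\<And>i. i \<in> I \<Longrightarrow> norm (f i) \<le> 1" "\<And>i. i \<in> I \<Longrightarrow> norm (g i) \<le> 1"
    and "\<And>i. i \<in> I \<Longrightarrow> norm (f i - g i) \<le> e"
  shows "norm ((\<Prod>i\<in>I. f i) - (\<Prod>i\<in>I. g i)) \<le> real (card I) * e"
proof -
  have "norm ((\<Prod>i\<in>I. f i) - (\<Prod>i\<in>I. g i)) \<le> (\<Sum>i\<in>I. norm (f i - g i))"
    using assms(1,2) by (rule norm_prod_diff)
  also have "\<dots> \<le> real (card I) * e" using assms(3) by (rule sum_bounded_above)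
  finally show ?thesis .
qed

lemma cz_signs_approx_large:
  fixes D :: real
  assumes F: "\<Union>F \<subseteq> {..<m}" "disjoint F" and D: "1 \<le> D" "\<And>T. T \<in> F \<Longrightarrow> D < real (card T)"
  obtains h where "op_degree_le m (4 * real l * real m / sqrt D) (diag_op m h)"
    and "\<And>X. \<bar>h X\<bar> \<le> 1" and "\<And>X. \<bar>h X - cz_signs F X\<bar> \<le> 2 * real m / 4 ^ l"
proof -
  have "finite F" using F(1) finite_subset by (blast intro: finite_UnionD)
  have large: "T \<subseteq> {..<m}" "card T \<ge> 2" if "T \<in> F" for T using F(1) D(1) D(2)[OF that] that by auto
  have weight: "(\<Sum>T\<in>F. card T) \<le> m" using sum_card_disjoint_le[OF _ F(2,1)] by simp
  have "\<exists>h. op_degree_le m (4 * real l * sqrt (card T)) (diag_op m h) \<and> (\<forall>X. \<bar>h X\<bar> \<le> 1) \<and>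
      (\<forall>X. \<bar>h X - cz_sign T X\<bar> \<le> 2 / 4 ^ l)" if "T \<in> F" for T
    using cz_sign_approx[OF large[OF that]] by metis
  then obtain g where
    g: "\<And>T. T \<in> F \<Longrightarrow> op_degree_le m (4 * real l * sqrt (card T)) (diag_op m (g T))"
      "\<And>T X. T \<in> F \<Longrightarrow> \<bar>g T X\<bar> \<le> 1" "\<And>T X. T \<in> F \<Longrightarrow> \<bar>g T X - cz_sign T X\<bar> \<le> 2 / 4 ^ l"
    by metis
  show ?thesis
  proof
    have "(\<Sum>T\<in>F. 4 * real l * sqrt (card T)) \<le> 4 * real l * (real (\<Sum>T\<in>F. card T) / sqrt D)"
      unfolding sum_distrib_left[symmetric] by (intro mult_left_mono sum_sqrt_card_le D) auto
    also have "\<dots> \<le> 4 * real l * (real m / sqrt D)"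
      using D(1) by (intro mult_left_mono divide_right_mono of_nat_mono weight) auto
    finally have "(\<Sum>T\<in>F. 4 * real l * sqrt (card T)) \<le> 4 * real l * real m / sqrt D" by simp
    from op_degree_le_mono[OF op_degree_le_diag_prod[OF \<open>finite F\<close> g(1)] this]
    show "op_degree_le m (4 * real l * real m / sqrt D) (diag_op m (\<lambda>X. \<Prod>T\<in>F. g T X))" .
    show "\<bar>\<Prod>T\<in>F. g T X\<bar> \<le> 1" for X by (rule abs_prod_le_1) (rule g(2))
    have "card F \<le> (\<Sum>T\<in>F. card T)" using large(2) sum_mono[of F "\<lambda>_. 1" card] by force
    with weight have "real (card F) * (2 / 4 ^ l) \<le> real m * (2 / 4 ^ l)"
      by (intro mult_right_mono) auto
    then show "\<bar>(\<Prod>T\<in>F. g T X) - cz_signs F X\<bar> \<le> 2 * real m / 4 ^ l" for X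
      using norm_prod_diff_le_card[of F "\<lambda>T. g T X" "\<lambda>T. cz_sign T X" "2 / 4 ^ l"] g(2,3)
      by (simp add: cz_signs_def mult.commute)
  qed
qed

lemma op_degree_le_heisenberg_diag_op:
  assumes h: "op_degree_le m t (diag_op m h)" and A: "op_degree_le m y A"
  shows "op_degree_le m (y + 2 * t) (heisenberg (diag_op m h) A)"
  using op_degree_le_mult[OF op_degree_le_mult[OF h A] h]
  by (simp add: heisenberg_def algebra_simps)

lemma cz_signs_approx_threshold:
  fixes D :: real
  assumes F: "\<Union>F \<subseteq> {..<m}" "disjoint F" and D: "1 \<le> D"
  obtains h where "\<And>X. \<bar>h X\<bar> \<le> 1" and "\<And>X. \<bar>h X - cz_signs F X\<bar> \<le> 2 * real m / 4 ^ l"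
    and "\<And>y A. op_degree_le m y A \<Longrightarrow>
      op_degree_le m (y * D + 8 * real l * real m / sqrt D) (heisenberg (diag_op m h) A)"
proof -
  define E where "E = {T \<in> F. real (card T) \<le> D}"
  define B where "B = {T \<in> F. D < real (card T)}"
  have E: "\<Union>E \<subseteq> {..<m}" "disjoint E" and B: "\<Union>B \<subseteq> {..<m}" "disjoint B"
    using F by (auto simp: E_def B_def pairwise_def)
  obtain h where h: "op_degree_le m (4 * real l * real m / sqrt D) (diag_op m h)"
    "\<And>X. \<bar>h X\<bar> \<le> 1" "\<And>X. \<bar>h X - cz_signs B X\<bar> \<le> 2 * real m / 4 ^ l"
    using cz_signs_approx_large[OF B D] by (auto simp: B_def)
  have "finite F" using F(1) finite_subset by (blast intro: finite_UnionD)
  from cz_signs_partition[OF this, of "\<lambda>T. real (card T) \<le> D"]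
  have split: "cz_signs F X = cz_signs E X * cz_signs B X" for X
    unfolding E_def B_def not_le by metis
  show ?thesis
  proof
    show "\<bar>cz_signs E X * h X\<bar> \<le> 1" for X using h(2) by (simp add: abs_mult)
    show "\<bar>cz_signs E X * h X - cz_signs F X\<bar> \<le> 2 * real m / 4 ^ l" for X
    proof -
      have "\<bar>cz_signs E X * h X - cz_signs F X\<bar> = \<bar>cz_signs E X\<bar> * \<bar>h X - cz_signs B X\<bar>"
        by (simp only: split right_diff_distrib[symmetric] abs_mult)
      then show ?thesis using h(3) by simp
    qed
    fix y A assume A: "op_degree_le m y A"
    have "op_degree_le m (y * D) (heisenberg (diag_op m (cz_signs E)) A)"
      by (rule op_degree_le_heisenberg_small_cz[OF A E D]) (simp add: E_def)
    from op_degree_le_heisenberg_diag_op[OF h(1) this]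
    show "op_degree_le m (y * D + 8 * real l * real m / sqrt D)
        (heisenberg (diag_op m (\<lambda>X. cz_signs E X * h X)) A)"
      by (simp add: heisenberg_mult[of _ "2 ^ m"] op_degree_le_carrier[OF A] mult.assoc
          flip: diag_op_mult)
  qed
qed

lemma powr_two_thirds_balance:
  fixes K y :: real
  assumes "0 < K" "0 < y"
  shows "y * (K / y) powr (2/3) = y powr (1/3) * K powr (2/3)"
    and "K / sqrt ((K / y) powr (2/3)) = y powr (1/3) * K powr (2/3)"
proof -
  have powr_thirds: "x / x powr (2/3) = x powr (1/3)" "x / x powr (1/3) = x powr (2/3)"
    if "0 < x" for x :: real
    using that powr_diff[of x 1 "2/3"] powr_diff[of x 1 "1/3"] by simp_all
  have "y * (K / y) powr (2/3) = (y / y powr (2/3)) * K powr (2/3)"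
    using assms by (simp add: powr_divide)
  then show "y * (K / y) powr (2/3) = y powr (1/3) * K powr (2/3)"
    using assms by (simp only: powr_thirds)
  have "sqrt ((K / y) powr (2/3)) = (K / y) powr (1/3)"
    using assms by (simp add: powr_powr flip: powr_half_sqrt)
  then have "K / sqrt ((K / y) powr (2/3)) = y powr (1/3) * (K / K powr (1/3))"
    using assms by (simp add: powr_divide)
  then show "K / sqrt ((K / y) powr (2/3)) = y powr (1/3) * K powr (2/3)"
    using assms by (simp only: powr_thirds)
qed

lemma two_mult_powr_third_le:
  fixes K :: real
  assumes "0 \<le> K"
  shows "2 * (K / 3) powr (2/3) \<le> K powr (2/3)"
proof -
  have "2 \<le> (3 :: real) powr (2/3)"
  proof (rule power_le_imp_le_base[of _ 2])
    show "(2 :: real) ^ Suc 2 \<le> (3 powr (2/3)) ^ Suc 2" by (simp add: powr_powr flip: powr_realpow)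
  qed simp
  then have "2 * (K / 3) powr (2/3) \<le> 3 powr (2/3) * (K / 3) powr (2/3)"
    by (rule mult_right_mono) simp
  then show ?thesis using assms by (simp flip: powr_mult)
qed

lemma cz_signs_approx:
  fixes K y :: real
  assumes F: "\<Union>F \<subseteq> {..<m}" "disjoint F"
    and K: "24 * real l * real m \<le> K" "3 * real m \<le> K" and y: "0 < y"
  obtains h where "\<And>X. \<bar>h X\<bar> \<le> 1" and "\<And>X. \<bar>h X - cz_signs F X\<bar> \<le> 2 * real m / 4 ^ l"
    and "\<And>A. op_degree_le m y A \<Longrightarrow>
      op_degree_le m (y powr (1/3) * K powr (2/3)) (heisenberg (diag_op m h) A)"
proof -
  have "0 \<le> K" using K(2) by (rule order_trans[rotated]) simp
  then have target: "2 * (y powr (1/3) * (K / 3) powr (2/3)) \<le> y powr (1/3) * K powr (2/3)"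
    using mult_left_mono[OF two_mult_powr_third_le, of K "y powr (1/3)"] by (simp add: ac_simps)
  show ?thesis
  proof (cases "y < K / 3")
    case True
    define D where "D = (K / 3 / y) powr (2/3)"
    have "D \<ge> 1" unfolding D_def using True y by (intro ge_one_powr_ge_zero) auto
    obtain h where h: "\<And>X. \<bar>h X\<bar> \<le> 1" "\<And>X. \<bar>h X - cz_signs F X\<bar> \<le> 2 * real m / 4 ^ l"
      "\<And>y A. op_degree_le m y A \<Longrightarrow>
        op_degree_le m (y * D + 8 * real l * real m / sqrt D) (heisenberg (diag_op m h) A)"
      using cz_signs_approx_threshold[OF F \<open>D \<ge> 1\<close>] by metis
    have "8 * real l * real m / sqrt D \<le> K / 3 / sqrt D"
      using K(1) \<open>D \<ge> 1\<close> by (intro divide_right_mono) auto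
    then have "y * D + 8 * real l * real m / sqrt D \<le> y powr (1/3) * K powr (2/3)"
      using powr_two_thirds_balance[of "K / 3" y] target True y unfolding D_def by linarith
    from that[OF h(1,2) op_degree_le_mono[OF h(3) this]] show ?thesis .
  next
    case False \<comment> \<open>the claimed degree is at least the number of qubits\<close>
    have "real m \<le> K / 3" using K(2) by simp
    also have "K / 3 = (K / 3) powr (1/3) * (K / 3) powr (2/3)"
      using \<open>0 \<le> K\<close> by (simp flip: powr_add)
    also have "\<dots> \<le> y powr (1/3) * (K / 3) powr (2/3)"
      using False \<open>0 \<le> K\<close> by (intro mult_right_mono powr_mono2) auto
    also have "\<dots> \<le> y powr (1/3) * K powr (2/3)"
      using \<open>0 \<le> K\<close> by (intro mult_left_mono powr_mono2) auto
    finally show ?thesis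
      by (intro that[of "cz_signs F"] op_degree_le_full) (simp_all add: op_degree_le_carrier)
  qed
qed

subsection \<open>Degree of approximate circuits\<close>

lemma qac0_compose_carrier:
  assumes "\<And>i. i \<le> j \<Longrightarrow> L i \<in> carrier_mat N N" "\<And>i. i \<in> {1..j} \<Longrightarrow> M i \<in> carrier_mat N N"
  shows "qac0_compose L M j \<in> carrier_mat N N"
  using assms by (induction j) simp_all

lemma op_degree_le_qac0_compose:
  assumes L: "\<And>i. i \<le> j \<Longrightarrow> is_single_qubit_layer m (L i)"
    and M: "\<And>i. i \<in> {1..j} \<Longrightarrow> M i \<in> operators m"
    and deg: "\<And>i A. i \<in> {1..j} \<Longrightarrow> op_degree_le m (y i) A \<Longrightarrow>
      op_degree_le m (y (i - 1)) (heisenberg (M i) A)"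
    and A: "op_degree_le m (y j) A"
  shows "op_degree_le m (y 0) (heisenberg (qac0_compose L M j) A)"
  using assms
proof (induction j arbitrary: A)
  case 0
  then show ?case by (simp add: op_degree_le_heisenberg_single_qubit_layer)
next
  case (Suc j)
  have L: "L i \<in> operators m" if "i \<le> Suc j" for i
    using Suc.prems(1)[OF that] by (rule is_single_qubit_layer_carrier)
  have "op_degree_le m (y (Suc j)) (heisenberg (L (Suc j)) A)"
    using Suc.prems(1,4) by (simp add: op_degree_le_heisenberg_single_qubit_layer)
  from Suc.prems(3)[OF _ this]
  have "op_degree_le m (y j) (heisenberg (M (Suc j)) (heisenberg (L (Suc j)) A))" by simp
  with Suc have "op_degree_le m (y 0) (heisenberg (qac0_compose L M j)
      (heisenberg (M (Suc j)) (heisenberg (L (Suc j)) A)))" by simp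
  moreover have "qac0_compose L M j \<in> operators m" "M (Suc j) \<in> operators m"
    using L Suc.prems(2) by (auto intro: qac0_compose_carrier)
  ultimately show ?case
    using L op_degree_le_carrier[OF Suc.prems(4)] by (simp add: heisenberg_mult[of _ "2 ^ m"])
qed

lemma powr_third_recurrence:
  fixes K y :: real
  assumes "0 < K" "0 < y"
  defines "z \<equiv> \<lambda>j. K * (y / K) powr (1 / 3 ^ j)"
  shows "z j powr (1/3) * K powr (2/3) = z (Suc j)"
proof -
  have "z j powr (1/3) * K powr (2/3) =
      (K powr (1/3) * K powr (2/3)) * ((y / K) powr (1 / 3 ^ j)) powr (1/3)"
    using assms by (simp add: powr_mult)
  also have "K powr (1/3) * K powr (2/3) = K" using assms by (simp flip: powr_add)
  finally show ?thesis by (simp add: z_def powr_powr mult.commute)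
qed

subsection \<open>The seminorm of a state\<close>

definition state_norm :: "complex mat \<Rightarrow> complex mat \<Rightarrow> real" where
  "state_norm \<rho> W = sqrt (Re (mtrace (W * \<rho> * mat_adjoint W)))"

lemma nonneg_quadratic_discriminant:
  fixes p b q :: real
  assumes nonneg: "\<And>t. 0 \<le> p + t * b + t\<^sup>2 * q" and "0 \<le> q"
  shows "b\<^sup>2 \<le> 4 * p * q"
proof (cases "q = 0")
  case True
  have "b = 0"
  proof (rule ccontr)
    assume "b \<noteq> 0"
    then show False using nonneg[of "- (p + 1) / b"] True by (simp add: field_simps)
  qed
  then show ?thesis using True by simp
next
  case False
  with \<open>0 \<le> q\<close> have "q > 0" by simp
  then show ?thesis using nonneg[of "- b / (2 * q)"] by (simp add: field_simps power2_eq_square)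
qed

locale state =
  fixes m :: nat and \<rho> :: "complex mat"
  assumes density: "density_operator m \<rho>"
begin

lemma density_carrier [simp]: "\<rho> \<in> operators m"
  using density by (simp add: density_operator_def)

abbreviation sandwich :: "complex mat \<Rightarrow> complex mat" where
  "sandwich W \<equiv> W * \<rho> * mat_adjoint W"

lemma sandwich_diag_nonneg:
  assumes W: "W \<in> operators m" and i: "i < 2 ^ m"
  shows "0 \<le> Re (sandwich W $$ (i, i))"
proof -
  define w where "w = col (mat_adjoint W) i"
  have w: "w \<in> carrier_vec (2 ^ m)"
    unfolding w_def by (rule col_carrier_vec[OF i mat_adjoint_carrier[OF W]])
  have conj_w: "row W i = conjugate w"
    using W i by (intro eq_vecI) (auto simp: w_def)
  have "sandwich W = W * (\<rho> * mat_adjoint W)"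
    by (rule assoc_mult_mat[OF W density_carrier mat_adjoint_carrier[OF W]])
  then have "sandwich W $$ (i, i) = row W i \<bullet> (\<rho> *\<^sub>v w)"
    using W i col_mult2[OF density_carrier mat_adjoint_carrier[OF W], of i] by (simp add: w_def)
  also have "\<dots> = (\<rho> *\<^sub>v w) \<bullet>c w"
    unfolding conj_w using w mult_mat_vec_carrier[OF density_carrier w]
    by (intro comm_scalar_prod) simp_all
  finally show ?thesis
    using density w by (simp add: density_operator_def less_eq_complex_def)
qed

lemma Re_mtrace_sandwich_nonneg: "W \<in> operators m \<Longrightarrow> 0 \<le> Re (mtrace (sandwich W))"
  unfolding mtrace_def Re_sum by (intro sum_nonneg sandwich_diag_nonneg) auto

lemma state_norm_nonneg: "W \<in> operators m \<Longrightarrow> 0 \<le> state_norm \<rho> W"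
  by (simp add: state_norm_def Re_mtrace_sandwich_nonneg)

lemma state_norm_square: "W \<in> operators m \<Longrightarrow> (state_norm \<rho> W)\<^sup>2 = Re (mtrace (sandwich W))"
  by (simp add: state_norm_def Re_mtrace_sandwich_nonneg)

lemma state_norm_add_smult_square:
  assumes W: "W \<in> operators m" and V: "V \<in> operators m"
  shows "(state_norm \<rho> (W + complex_of_real t \<cdot>\<^sub>m V))\<^sup>2 = (state_norm \<rho> W)\<^sup>2 +
    t * Re (mtrace (V * \<rho> * mat_adjoint W) + mtrace (W * \<rho> * mat_adjoint V)) +
    t\<^sup>2 * (state_norm \<rho> V)\<^sup>2"
proof -
  let ?N = "2 ^ m :: nat" and ?t = "complex_of_real t"
  have expand: "sandwich (W + ?t \<cdot>\<^sub>m V) =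
    sandwich W + ?t \<cdot>\<^sub>m (V * \<rho> * mat_adjoint W) +
    (?t \<cdot>\<^sub>m (W * \<rho> * mat_adjoint V) + ?t \<cdot>\<^sub>m (?t \<cdot>\<^sub>m sandwich V))"
    using W V density_carrier
    by (simp add: mat_adjoint_add[of _ ?N ?N] mat_adjoint_smult square_mat_distribs[where N = ?N])
  have "mtrace (sandwich (W + ?t \<cdot>\<^sub>m V)) = mtrace (sandwich W) +
      ?t * (mtrace (V * \<rho> * mat_adjoint W) + mtrace (W * \<rho> * mat_adjoint V)) +
      complex_of_real (t\<^sup>2) * mtrace (sandwich V)"
    unfolding expand using W V density_carrier
    by (simp add: mtrace_add[of _ ?N] mtrace_smult[of _ ?N] power2_eq_square algebra_simps)
  then show ?thesis
    using W V by (simp add: state_norm_square)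
qed

lemma state_norm_triangle:
  assumes W: "W \<in> operators m" and V: "V \<in> operators m"
  shows "state_norm \<rho> (W + V) \<le> state_norm \<rho> W + state_norm \<rho> V"
proof -
  let ?b = "Re (mtrace (V * \<rho> * mat_adjoint W) + mtrace (W * \<rho> * mat_adjoint V))"
  have "?b\<^sup>2 \<le> 4 * (state_norm \<rho> W)\<^sup>2 * (state_norm \<rho> V)\<^sup>2"
  proof (rule nonneg_quadratic_discriminant)
    show "0 \<le> (state_norm \<rho> W)\<^sup>2 + t * ?b + t\<^sup>2 * (state_norm \<rho> V)\<^sup>2" for t
      unfolding state_norm_add_smult_square[OF W V, symmetric] by simp
  qed simp
  also have "\<dots> = (2 * state_norm \<rho> W * state_norm \<rho> V)\<^sup>2" by (simp add: power2_eq_square)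
  finally have "?b \<le> 2 * state_norm \<rho> W * state_norm \<rho> V"
    by (rule power2_le_imp_le) (simp add: W V state_norm_nonneg)
  moreover have "1 \<cdot>\<^sub>m V = V" by (rule eq_matI) auto
  ultimately have "(state_norm \<rho> (W + V))\<^sup>2 \<le> (state_norm \<rho> W + state_norm \<rho> V)\<^sup>2"
    using state_norm_add_smult_square[OF W V, of 1] by (simp add: power2_sum)
  then show ?thesis
    by (rule power2_le_imp_le) (simp add: W V state_norm_nonneg)
qed

lemma state_norm_uminus:
  assumes W: "W \<in> operators m"
  shows "state_norm \<rho> (- W) = state_norm \<rho> W"
proof -
  have "mat_adjoint (- W) = - mat_adjoint W" by (rule eq_matI) auto
  then show ?thesis
    using carrier_matD[OF W] carrier_matD[OF density_carrier] by (simp add: state_norm_def)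
qed

lemma state_norm_le_add_diff:
  assumes W: "W \<in> operators m" and V: "V \<in> operators m"
  shows "state_norm \<rho> W \<le> state_norm \<rho> V + state_norm \<rho> (W - V)"
proof -
  have "V + (W - V) = W" using W V by (intro eq_matI) auto
  then show ?thesis using state_norm_triangle[OF V minus_carrier_mat[OF V], of W] by simp
qed

lemma abs_state_norm_diff_le:
  assumes W: "W \<in> operators m" and V: "V \<in> operators m"
  shows "\<bar>state_norm \<rho> W - state_norm \<rho> V\<bar> \<le> state_norm \<rho> (W - V)"
proof -
  have "V - W = - (W - V)" using W V by (intro eq_matI) auto
  then have "state_norm \<rho> (V - W) = state_norm \<rho> (W - V)"
    using V by (simp add: state_norm_uminus minus_carrier_mat)
  then show ?thesis
    using state_norm_le_add_diff[OF W V] state_norm_le_add_diff[OF V W] by simp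
qed

lemma state_norm_unitary_mult:
  assumes L: "unitary_mat (2 ^ m) L" and W: "W \<in> operators m"
  shows "state_norm \<rho> (L * W) = state_norm \<rho> W"
proof -
  let ?N = "2 ^ m :: nat"
  have L_carrier: "L \<in> operators m" and isometry: "mat_adjoint L * L = 1\<^sub>m ?N"
    using L by (auto simp: unitary_mat_def)
  have "mtrace (sandwich (L * W)) = mtrace (L * (sandwich W * mat_adjoint L))"
    using L_carrier W density_carrier
    by (simp add: mat_adjoint_mult[of _ ?N ?N _ ?N] square_mult_assoc[where N = ?N])
  also have "\<dots> = mtrace (sandwich W * mat_adjoint L * L)"
    by (rule mtrace_mult_commute[of _ ?N ?N]) (use L_carrier W density_carrier in simp_all)
  also have "\<dots> = mtrace (sandwich W * (mat_adjoint L * L))"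
    using L_carrier W density_carrier by (simp add: square_mult_assoc[where N = ?N])
  also have "\<dots> = mtrace (sandwich W)"
    using W density_carrier by (simp add: isometry square_mult_one[where N = ?N])
  finally show ?thesis by (simp add: state_norm_def)
qed

lemma state_norm_unitary:
  assumes L: "unitary_mat (2 ^ m) L"
  shows "state_norm \<rho> L = 1"
proof -
  have one: "mat_adjoint (1\<^sub>m (2 ^ m)) = (1\<^sub>m (2 ^ m) :: complex mat)" by (rule eq_matI) auto
  have "state_norm \<rho> L = state_norm \<rho> (1\<^sub>m (2 ^ m))"
    using L state_norm_unitary_mult[OF L, of "1\<^sub>m (2 ^ m)"]
    by (simp add: unitary_mat_def square_mult_one[where N = "2 ^ m"])
  also have "\<dots> = 1"
    using density density_carrier
    by (simp add: state_norm_def one density_operator_def square_mult_one[where N = "2 ^ m"])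
  finally show ?thesis .
qed

lemma state_norm_diag_op_mult_le:
  assumes W: "W \<in> operators m" and h: "\<And>X. \<bar>h X\<bar> \<le> c"
  shows "state_norm \<rho> (diag_op m h * W) \<le> c * state_norm \<rho> W"
proof -
  let ?N = "2 ^ m :: nat" and ?H = "diag_op m h"
  have sandwich: "sandwich (?H * W) = ?H * (sandwich W * ?H)"
    using W density_carrier
    by (simp add: mat_adjoint_mult[of _ ?N ?N _ ?N] square_mult_assoc[where N = ?N])
  have "mtrace (?H * (sandwich W * ?H)) = mtrace (sandwich W * ?H * ?H)"
    by (rule mtrace_mult_commute[of _ ?N ?N]) (use W density_carrier in simp_all)
  also have "\<dots> = mtrace (sandwich W * diag_op m (\<lambda>X. (h X)\<^sup>2))"
    using W density_carrier
    by (simp add: diag_op_mult power2_eq_square square_mult_assoc[where N = ?N])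
  also have "\<dots> = mtrace (diag_op m (\<lambda>X. (h X)\<^sup>2) * sandwich W)"
    by (rule mtrace_mult_commute[of _ ?N ?N]) (use W density_carrier in simp_all)
  also have "\<dots> = (\<Sum>X\<in>Pow {..<m}. complex_of_real ((h X)\<^sup>2) * set_entry (sandwich W) X X)"
    using W density_carrier by (simp add: mtrace_set_entry[of _ m] set_entry_diag_op_mult)
  finally have "(state_norm \<rho> (?H * W))\<^sup>2 =
      (\<Sum>X\<in>Pow {..<m}. (h X)\<^sup>2 * Re (set_entry (sandwich W) X X))"
    using W by (simp add: state_norm_square sandwich)
  also have "\<dots> \<le> (\<Sum>X\<in>Pow {..<m}. c\<^sup>2 * Re (set_entry (sandwich W) X X))"
  proof (intro sum_mono mult_right_mono)
    show "(h X)\<^sup>2 \<le> c\<^sup>2" for X using h[of X] abs_le_square_iff[of "h X" c] by linarith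
    show "0 \<le> Re (set_entry (sandwich W) X X)" if "X \<in> Pow {..<m}" for X
      unfolding set_entry_def using that W by (intro sandwich_diag_nonneg set_encode_less) auto
  qed
  also have "\<dots> = (c * state_norm \<rho> W)\<^sup>2"
    using W density_carrier
    by (simp add: power_mult_distrib state_norm_square mtrace_set_entry[of _ m] sum_distrib_left)
  finally show ?thesis
    by (rule power2_le_imp_le) (use W h[of "{}"] in \<open>simp add: state_norm_nonneg\<close>)
qed

end

subsection \<open>Error of an approximate circuit\<close>

context state
begin

lemma state_norm_layer_le:
  assumes L: "is_single_qubit_layer m L" and h: "\<And>X. \<bar>h X\<bar> \<le> 1" and C: "C \<in> operators m"
  shows "state_norm \<rho> (L * diag_op m h * C) \<le> state_norm \<rho> C"
proof -
  have "L * diag_op m h * C = L * (diag_op m h * C)"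
    by (rule assoc_mult_mat[OF is_single_qubit_layer_carrier[OF L] diag_op_carrier C])
  then have "state_norm \<rho> (L * diag_op m h * C) = state_norm \<rho> (diag_op m h * C)"
    using C by (simp add: state_norm_unitary_mult is_single_qubit_layer_unitary[OF L])
  also have "\<dots> \<le> 1 * state_norm \<rho> C" using C h by (rule state_norm_diag_op_mult_le)
  finally show ?thesis by simp
qed

lemma state_norm_layer_diff_le:
  assumes L: "is_single_qubit_layer m L" and h: "\<And>X. \<bar>h X\<bar> \<le> 1"
    and gh: "\<And>X. \<bar>g X - h X\<bar> \<le> \<delta>" and C: "C \<in> operators m" "C' \<in> operators m"
  shows "state_norm \<rho> (L * diag_op m g * C - L * diag_op m h * C') \<le>
    \<delta> * state_norm \<rho> C + state_norm \<rho> (C - C')"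
proof -
  let ?N = "2 ^ m :: nat" and ?G = "diag_op m g" and ?H = "diag_op m h"
  let ?E = "diag_op m (\<lambda>X. g X - h X)"
  note [simp] = is_single_qubit_layer_carrier[OF L] C C[THEN minus_carrier_mat]
  have telescope: "A - B + (B - C) = A - C"
    if "A \<in> operators m" "B \<in> operators m" "C \<in> operators m" for A B C
    using that by (intro eq_matI) auto
  have "L * ?G * C - L * ?H * C' = L * (?G * C - ?H * C')"
    by (simp add: square_mult_assoc[where N = ?N] square_mat_distribs[where N = ?N])
  also have "?G * C - ?H * C' = ?E * C + ?H * (C - C')"
    unfolding diag_op_diff[symmetric]
    by (simp add: square_mat_distribs[where N = ?N] telescope)
  finally have "state_norm \<rho> (L * ?G * C - L * ?H * C') = state_norm \<rho> (?E * C + ?H * (C - C'))"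
    by (simp add: state_norm_unitary_mult is_single_qubit_layer_unitary[OF L])
  also have "\<dots> \<le> state_norm \<rho> (?E * C) + state_norm \<rho> (?H * (C - C'))"
    by (intro state_norm_triangle) simp_all
  also have "\<dots> \<le> \<delta> * state_norm \<rho> C + 1 * state_norm \<rho> (C - C')"
    using h gh by (intro add_mono state_norm_diag_op_mult_le) simp_all
  finally show ?thesis by simp
qed

lemma state_norm_qac0_compose_le_1:
  assumes L: "\<And>i. i \<le> j \<Longrightarrow> is_single_qubit_layer m (L i)"
    and h: "\<And>i X. i \<in> {1..j} \<Longrightarrow> \<bar>h i X\<bar> \<le> 1"
  shows "state_norm \<rho> (qac0_compose L (\<lambda>i. diag_op m (h i)) j) \<le> 1"
  using assms
proof (induction j)
  case 0
  then show ?case by (simp add: is_single_qubit_layer_unitary state_norm_unitary)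
next
  case (Suc j)
  let ?C = "qac0_compose L (\<lambda>i. diag_op m (h i)) j"
  have "?C \<in> operators m"
    using Suc.prems(1) by (intro qac0_compose_carrier) (auto intro: is_single_qubit_layer_carrier)
  then have "state_norm \<rho> (L (Suc j) * diag_op m (h (Suc j)) * ?C) \<le> state_norm \<rho> ?C"
    using Suc.prems by (intro state_norm_layer_le) auto
  also have "\<dots> \<le> 1" using Suc by simp
  finally show ?case by simp
qed

lemma state_norm_qac0_compose_diff_le:
  assumes L: "\<And>i. i \<le> j \<Longrightarrow> is_single_qubit_layer m (L i)"
    and g: "\<And>i X. i \<in> {1..j} \<Longrightarrow> \<bar>g i X\<bar> \<le> 1" and h: "\<And>i X. i \<in> {1..j} \<Longrightarrow> \<bar>h i X\<bar> \<le> 1"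
    and gh: "\<And>i X. i \<in> {1..j} \<Longrightarrow> \<bar>g i X - h i X\<bar> \<le> \<delta>"
  shows "state_norm \<rho> (qac0_compose L (\<lambda>i. diag_op m (g i)) j -
    qac0_compose L (\<lambda>i. diag_op m (h i)) j) \<le> real j * \<delta>"
  using assms
proof (induction j)
  case 0
  then have "L 0 \<in> operators m" by (intro is_single_qubit_layer_carrier) simp
  then show ?case
    using density_carrier by (simp add: minus_r_inv_mat state_norm_def mtrace_def
        left_mult_zero_mat[of _ "2 ^ m" "2 ^ m"])
next
  case (Suc j)
  let ?C = "qac0_compose L (\<lambda>i. diag_op m (g i)) j"
  let ?C' = "qac0_compose L (\<lambda>i. diag_op m (h i)) j"
  have "?C \<in> operators m" "?C' \<in> operators m"
    using Suc.prems(1) by (auto intro!: qac0_compose_carrier intro: is_single_qubit_layer_carrier)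
  then have "state_norm \<rho> (L (Suc j) * diag_op m (g (Suc j)) * ?C -
      L (Suc j) * diag_op m (h (Suc j)) * ?C') \<le> \<delta> * state_norm \<rho> ?C + state_norm \<rho> (?C - ?C')"
    using Suc.prems by (intro state_norm_layer_diff_le) auto
  also have "\<dots> \<le> \<delta> * 1 + real j * \<delta>"
  proof (intro add_mono mult_left_mono)
    show "state_norm \<rho> ?C \<le> 1" using Suc.prems by (intro state_norm_qac0_compose_le_1) simp_all
    show "state_norm \<rho> (?C - ?C') \<le> real j * \<delta>" using Suc by simp
    show "0 \<le> \<delta>" using Suc.prems(4)[of "Suc j" "{}"] by simp
  qed
  finally show ?case by (simp add: algebra_simps)
qed

end

subsection \<open>Input states\<close>

definition with_ancilla :: "nat \<Rightarrow> nat set \<Rightarrow> nat set \<Rightarrow> nat set" where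
  "with_ancilla n x I = x \<union> (+) n ` I"

lemma with_ancilla_subset:
  "x \<subseteq> {..<n} \<Longrightarrow> I \<subseteq> {..<a} \<Longrightarrow> with_ancilla n x I \<subseteq> {..<n + a}"
  by (auto simp: with_ancilla_def)

lemma vimage_with_ancilla: "x \<subseteq> {..<n} \<Longrightarrow> (+) n -` with_ancilla n x I = I"
  by (auto simp: with_ancilla_def)

lemma sum_with_ancilla:
  assumes "x \<subseteq> {..<n}"
  shows "(\<Sum>Y\<in>Pow {..<n + a}. if Y \<inter> {..<n} = x then f Y else 0) =
    (\<Sum>I\<in>Pow {..<a}. f (with_ancilla n x I))"
proof -
  have "(\<Sum>Y\<in>Pow {..<n + a}. if Y \<inter> {..<n} = x then f Y else 0) =
    (\<Sum>Y\<in>{Y \<in> Pow {..<n + a}. Y \<inter> {..<n} = x}. f Y)"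
    by (rule sum.inter_filter[symmetric]) simp
  also have "\<dots> = (\<Sum>I\<in>Pow {..<a}. f (with_ancilla n x I))"
  proof (rule sum.reindex_bij_witness[of _ "with_ancilla n x" "\<lambda>Y. (+) n -` Y"])
    fix Y assume Y: "Y \<in> {Y \<in> Pow {..<n + a}. Y \<inter> {..<n} = x}"
    have "i \<in> Y \<longleftrightarrow> i \<in> x \<or> (\<exists>k. n + k \<in> Y \<and> i = n + k)" for i
      using Y by (cases "i < n") (auto simp: not_less le_iff_add)
    then show eq: "with_ancilla n x ((+) n -` Y) = Y" unfolding with_ancilla_def by blast
    then show "f (with_ancilla n x ((+) n -` Y)) = f Y" by simp
    show "(+) n -` Y \<in> Pow {..<a}" using Y by auto
  qed (use assms in \<open>auto simp: with_ancilla_def\<close>)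
  finally show ?thesis .
qed

lemma set_encode_div_power: "set_encode A div 2 ^ n = set_encode ((+) n -` A)"
proof (induction n arbitrary: A)
  case (Suc n)
  have "set_encode A div 2 ^ Suc n = set_encode (Suc -` A) div 2 ^ n"
    by (simp add: set_encode_vimage_Suc div_mult2_eq)
  also have "\<dots> = set_encode ((+) n -` Suc -` A)" by (rule Suc)
  also have "(+) n -` Suc -` A = (+) (Suc n) -` A" by auto
  finally show ?case .
qed (simp add: vimage_def)

lemma input_state_carrier [simp]: "input_state n a x \<phi> \<in> operators (n + a)"
  by (simp add: input_state_def)

lemma set_entry_input_state:
  assumes "x \<subseteq> {..<n}" "Y \<subseteq> {..<n + a}" "Z \<subseteq> {..<n + a}"
  shows "set_entry (input_state n a x \<phi>) Y Z = (if Y \<inter> {..<n} = x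
    then if Z \<inter> {..<n} = x then set_entry \<phi> ((+) n -` Y) ((+) n -` Z) else 0 else 0)"
proof -
  have "(\<forall>k<n. (k \<in> Y \<longleftrightarrow> k \<in> x) \<and> (k \<in> Z \<longleftrightarrow> k \<in> x)) \<longleftrightarrow> Y \<inter> {..<n} = x \<and> Z \<inter> {..<n} = x"
    using assms(1) by blast
  then show ?thesis
    using assms
    by (simp add: input_state_def set_entry_mat qbit_set_encode set_encode_div_power
        set_entry_def[of \<phi>])
qed

lemma sum_set_entry_input_state:
  assumes x: "x \<subseteq> {..<n}"
  shows "(\<Sum>Y\<in>Pow {..<n + a}. \<Sum>Z\<in>Pow {..<n + a}.
      set_entry (input_state n a x \<phi>) Y Z * f Y Z) =
    (\<Sum>I\<in>Pow {..<a}. \<Sum>J\<in>Pow {..<a}. set_entry \<phi> I J * f (with_ancilla n x I) (with_ancilla n x J))"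
proof -
  let ?M = "Pow {..<n + a}"
  have "(\<Sum>Y\<in>?M. \<Sum>Z\<in>?M. set_entry (input_state n a x \<phi>) Y Z * f Y Z) =
      (\<Sum>Y\<in>?M. if Y \<inter> {..<n} = x then \<Sum>Z\<in>?M. if Z \<inter> {..<n} = x then
        set_entry \<phi> ((+) n -` Y) ((+) n -` Z) * f Y Z else 0 else 0)"
    by (intro sum.cong refl) (auto simp: set_entry_input_state[OF x] intro!: sum.cong sum.neutral)
  then show ?thesis by (simp add: sum_with_ancilla[OF x] vimage_with_ancilla[OF x])
qed

lemma quadratic_form_set_entry:
  assumes "A \<in> operators m" "v \<in> carrier_vec (2 ^ m)"
  shows "(A *\<^sub>v v) \<bullet>c v = (\<Sum>X\<in>Pow {..<m}. \<Sum>Y\<in>Pow {..<m}.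
    set_entry A X Y * (v $ set_encode Y * cnj (v $ set_encode X)))"
proof -
  have "(A *\<^sub>v v) \<bullet>c v = (\<Sum>i<2 ^ m. (\<Sum>j<2 ^ m. A $$ (i, j) * v $ j) * cnj (v $ i))"
    using assms by (simp add: scalar_prod_def atLeast0LessThan)
  then show ?thesis
    by (simp add: sum_set_encode set_entry_def sum_distrib_right mult.assoc)
qed

lemma density_operator_input_state:
  assumes \<phi>: "density_operator a \<phi>" and x: "x \<subseteq> {..<n}"
  shows "density_operator (n + a) (input_state n a x \<phi>)"
proof -
  have carrier: "\<phi> \<in> operators a" using \<phi> by (simp add: density_operator_def)
  have psd: "0 \<le> (input_state n a x \<phi> *\<^sub>v v) \<bullet>c v" if v: "v \<in> carrier_vec (2 ^ (n + a))" for v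
  proof -
    define w where "w = vec (2 ^ a) (\<lambda>i. v $ set_encode (with_ancilla n x (set_decode i)))"
    have w: "w \<in> carrier_vec (2 ^ a)" by (simp add: w_def)
    have "w $ set_encode I = v $ set_encode (with_ancilla n x I)" if "I \<in> Pow {..<a}" for I
      using that by (simp add: w_def set_encode_less finite_subset)
    then have "(input_state n a x \<phi> *\<^sub>v v) \<bullet>c v = (\<phi> *\<^sub>v w) \<bullet>c w"
      by (simp add: quadratic_form_set_entry[OF input_state_carrier v]
          quadratic_form_set_entry[OF carrier w] sum_set_entry_input_state[OF x])
    then show ?thesis using \<phi> w by (simp add: density_operator_def)
  qed
  have "mtrace (input_state n a x \<phi>) = (\<Sum>Y\<in>Pow {..<n + a}.
      if Y \<inter> {..<n} = x then set_entry \<phi> ((+) n -` Y) ((+) n -` Y) else 0)"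
    unfolding mtrace_set_entry[OF input_state_carrier]
    by (intro sum.cong refl) (simp add: set_entry_input_state[OF x])
  also have "\<dots> = mtrace \<phi>"
    using carrier by (simp add: sum_with_ancilla[OF x] vimage_with_ancilla[OF x] mtrace_set_entry)
  finally show ?thesis using \<phi> psd by (simp add: density_operator_def)
qed

lemma mtrace_mult_input_state:
  assumes B: "B \<in> operators (n + a)" and x: "x \<subseteq> {..<n}"
  shows "mtrace (B * input_state n a x \<phi>) = (\<Sum>I\<in>Pow {..<a}. \<Sum>J\<in>Pow {..<a}.
    set_entry \<phi> I J * set_entry B (with_ancilla n x J) (with_ancilla n x I))"
proof -
  have "mtrace (B * input_state n a x \<phi>) = mtrace (input_state n a x \<phi> * B)"
    by (rule mtrace_mult_commute[OF B input_state_carrier])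
  also have "\<dots> = (\<Sum>Y\<in>Pow {..<n + a}. \<Sum>Z\<in>Pow {..<n + a}.
      set_entry (input_state n a x \<phi>) Y Z * set_entry B Z Y)"
    using B by (simp add: mtrace_set_entry[of _ "n + a"] set_entry_mult[of _ "n + a"])
  finally show ?thesis by (simp add: sum_set_entry_input_state[OF x])
qed

subsection \<open>Acceptance probabilities\<close>

lemma proj_one_eq_diag_op: "proj_one m = diag_op m (\<lambda>X. of_bool (0 \<in> X))"
  unfolding proj_one_def diag_op_def
  by (intro arg_cong[where f = "mat _ _"] ext) (auto simp: qbit_iff_set_decode)

lemma proj_one_carrier [simp]: "proj_one m \<in> operators m"
  by (simp add: proj_one_def)

lemma accept_prob_heisenberg:
  assumes V: "V \<in> operators (n + a)"
  shows "accept_prob n a V \<phi> x =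
    Re (mtrace (heisenberg V (proj_one (n + a)) * input_state n a x \<phi>))"
proof -
  let ?N = "2 ^ (n + a) :: nat" and ?P = "proj_one (n + a)" and ?\<rho> = "input_state n a x \<phi>"
  note assoc = square_mult_assoc[where N = ?N]
  have "mtrace (?P * (V * ?\<rho> * mat_adjoint V)) = mtrace (?P * (V * ?\<rho>) * mat_adjoint V)"
    using V by (simp add: assoc)
  also have "\<dots> = mtrace (mat_adjoint V * (?P * (V * ?\<rho>)))"
    by (rule mtrace_mult_commute[of _ ?N ?N]) (use V in simp_all)
  also have "\<dots> = mtrace (heisenberg V ?P * ?\<rho>)"
    using V by (simp add: heisenberg_def assoc)
  finally show ?thesis by (simp add: accept_prob_def)
qed

lemma accept_prob_eq_state_norm:
  assumes V: "V \<in> operators (n + a)" and \<phi>: "density_operator a \<phi>" and x: "x \<subseteq> {..<n}"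
  shows "accept_prob n a V \<phi> x = (state_norm (input_state n a x \<phi>) (proj_one (n + a) * V))\<^sup>2"
proof -
  let ?N = "2 ^ (n + a) :: nat" and ?P = "proj_one (n + a)" and ?\<rho> = "input_state n a x \<phi>"
  interpret state "n + a" ?\<rho>
    by unfold_locales (rule density_operator_input_state[OF \<phi> x])
  note assoc = square_mult_assoc[where N = ?N]
  have P: "mat_adjoint ?P = ?P" "?P * ?P = ?P"
    by (simp_all add: proj_one_eq_diag_op diag_op_mult flip: of_bool_conj)
  have "mtrace (sandwich (?P * V)) = mtrace (?P * (V * ?\<rho> * mat_adjoint V) * ?P)"
    using V by (simp add: mat_adjoint_mult[of _ ?N ?N _ ?N] assoc P)
  also have "\<dots> = mtrace (?P * (?P * (V * ?\<rho> * mat_adjoint V)))"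
    by (rule mtrace_mult_commute[of _ ?N ?N]) (use V in simp_all)
  also have "\<dots> = mtrace (?P * ?P * (V * ?\<rho> * mat_adjoint V))"
    using V by (simp add: assoc)
  finally show ?thesis
    using V by (simp add: state_norm_square accept_prob_def P)
qed

lemma accept_prob_diff_le:
  assumes U: "U \<in> operators (n + a)" and V: "V \<in> operators (n + a)"
    and \<phi>: "density_operator a \<phi>" and x: "x \<subseteq> {..<n}"
    and norm: "state_norm (input_state n a x \<phi>) U \<le> 1" "state_norm (input_state n a x \<phi>) V \<le> 1"
    and diff: "state_norm (input_state n a x \<phi>) (U - V) \<le> e"
  shows "\<bar>accept_prob n a U \<phi> x - accept_prob n a V \<phi> x\<bar> \<le> 2 * e"
proof -
  let ?\<rho> = "input_state n a x \<phi>" and ?P = "proj_one (n + a)"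
  interpret state "n + a" ?\<rho>
    by unfold_locales (rule density_operator_input_state[OF \<phi> x])
  have P: "state_norm ?\<rho> (?P * W) \<le> state_norm ?\<rho> W" if "W \<in> operators (n + a)" for W
    using state_norm_diag_op_mult_le[OF that, of "\<lambda>X. of_bool (0 \<in> X)" 1]
    by (simp add: proj_one_eq_diag_op)
  define u where "u = state_norm ?\<rho> (?P * U)"
  define v where "v = state_norm ?\<rho> (?P * V)"
  have "\<bar>u - v\<bar> \<le> state_norm ?\<rho> (?P * U - ?P * V)"
    unfolding u_def v_def using U V by (intro abs_state_norm_diff_le) simp_all
  also have "?P * U - ?P * V = ?P * (U - V)"
    using U V by (simp add: mult_minus_distrib_mat[OF proj_one_carrier])
  also have "state_norm ?\<rho> \<dots> \<le> e" using P[of "U - V"] V diff by (simp add: minus_carrier_mat)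
  finally have "\<bar>u - v\<bar> \<le> e" .
  moreover have "0 \<le> u" "u \<le> 1" "0 \<le> v" "v \<le> 1"
    using P[OF U] P[OF V] norm U V by (simp_all add: u_def v_def state_norm_nonneg)
  ultimately have "\<bar>u - v\<bar> * \<bar>u + v\<bar> \<le> e * 2" by (intro mult_mono) auto
  moreover have "u\<^sup>2 - v\<^sup>2 = (u - v) * (u + v)" by (simp add: power2_eq_square algebra_simps)
  ultimately have "\<bar>u\<^sup>2 - v\<^sup>2\<bar> \<le> 2 * e" by (simp add: abs_mult)
  then show ?thesis
    using U V by (simp add: accept_prob_eq_state_norm[OF _ \<phi> x] u_def v_def)
qed

subsection \<open>Fourier degree of acceptance probabilities\<close>

definition flip :: "nat \<Rightarrow> nat set \<Rightarrow> nat set" where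
  "flip k x = (if k \<in> x then x - {k} else insert k x)"

lemma flip_flip: "flip k (flip k x) = x"
  by (auto simp: flip_def)

lemma flip_subset: "k < n \<Longrightarrow> x \<subseteq> {..<n} \<Longrightarrow> flip k x \<subseteq> {..<n}"
  by (auto simp: flip_def)

lemma chi_flip:
  assumes "finite T" "k \<in> T"
  shows "chi T (flip k x) = - chi T x"
proof -
  have insert: "chi T (insert k x) = - chi T x" if "k \<notin> x" for x
    using assms that by (simp add: chi_def)
  show ?thesis
  proof (cases "k \<in> x")
    case True
    then show ?thesis using insert[of "x - {k}"] by (simp add: flip_def insert_absorb)
  qed (simp add: insert flip_def)
qed

lemma fourier_coeff_eq_0_if_flip_invariant:
  assumes T: "k \<in> T" "T \<subseteq> {..<n}" and g: "\<And>x. x \<subseteq> {..<n} \<Longrightarrow> g (flip k x) = g x"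
  shows "fourier_coeff n g T = 0"
proof -
  have "finite T" "k < n" using T finite_subset by blast+
  have "(\<Sum>x\<in>Pow {..<n}. g x * chi T x) = (\<Sum>x\<in>Pow {..<n}. g (flip k x) * chi T (flip k x))"
    by (rule sum.reindex_bij_witness[of _ "flip k" "flip k"])
      (auto simp: flip_flip dest: flip_subset[OF \<open>k < n\<close>])
  also have "\<dots> = - (\<Sum>x\<in>Pow {..<n}. g x * chi T x)"
    unfolding sum_negf[symmetric]
    using g by (intro sum.cong refl) (simp add: chi_flip[OF \<open>finite T\<close> T(1)])
  finally show ?thesis by (simp add: fourier_coeff_def)
qed

lemma fourier_coeff_add:
  "fourier_coeff n (\<lambda>x. f x + g x) T = fourier_coeff n f T + fourier_coeff n g T"
  by (simp add: fourier_coeff_def distrib_right sum.distrib add_divide_distrib)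

lemma set_entry_flip_outside_support:
  assumes B: "supported_on (n + a) S B" and k: "k < n" "k \<notin> S"
    and x: "x \<subseteq> {..<n}" and IJ: "I \<subseteq> {..<a}" "J \<subseteq> {..<a}"
  shows "set_entry B (with_ancilla n (flip k x) I) (with_ancilla n (flip k x) J) =
    set_entry B (with_ancilla n x I) (with_ancilla n x J)"
proof -
  have Int: "with_ancilla n (flip k x) I \<inter> S = with_ancilla n x I \<inter> S" for I
    using k by (auto simp: with_ancilla_def flip_def)
  have Diff: "with_ancilla n z I - S = with_ancilla n z J - S \<longleftrightarrow> (+) n ` I - S = (+) n ` J - S"
    if "z \<subseteq> {..<n}" for z
    using that by (auto simp: with_ancilla_def)
  have flip: "flip k x \<subseteq> {..<n}" by (rule flip_subset[OF k(1) x])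
  have sub: "with_ancilla n z I \<subseteq> {..<n + a}" "with_ancilla n z J \<subseteq> {..<n + a}"
    if "z \<subseteq> {..<n}" for z
    using with_ancilla_subset[OF that] IJ by blast+
  show ?thesis
    by (simp only: supported_onD[OF B sub[OF x]] supported_onD[OF B sub[OF flip]] Int
        Diff[OF x] Diff[OF flip])
qed

lemma fourier_coeff_expectation_eq_0:
  assumes "op_degree_le (n + a) y B" and T: "T \<subseteq> {..<n}" "y < real (card T)"
  shows "fourier_coeff n (\<lambda>x. Re (mtrace (B * input_state n a x \<phi>))) T = 0"
  using assms(1)
proof induction
  case (supported S B)
  have "finite S" using supported(1) finite_subset by blast
  then have "\<not> T \<subseteq> S" using card_mono[of S T] T(2) supported(2) by auto
  then obtain k where k: "k \<in> T" "k \<notin> S" by blast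
  then have "k < n" using T(1) by blast
  show ?case
  proof (rule fourier_coeff_eq_0_if_flip_invariant[OF k(1) T(1)])
    fix x assume x: "x \<subseteq> {..<n}"
    show "Re (mtrace (B * input_state n a (flip k x) \<phi>)) = Re (mtrace (B * input_state n a x \<phi>))"
      using set_entry_flip_outside_support[OF supported(3) \<open>k < n\<close> k(2) x]
      by (simp add: mtrace_mult_input_state[OF supported_on_carrier[OF supported(3)]] x
          flip_subset[OF \<open>k < n\<close> x])
  qed
next
  case (add A B)
  then show ?case
    by (simp add: square_mat_distribs[where N = "2 ^ (n + a)"]
        mtrace_add[of _ "2 ^ (n + a)"] op_degree_le_carrier fourier_coeff_add)
qed

lemma fdeg_le:
  assumes "0 \<le> y" "\<And>T. T \<subseteq> {..<n} \<Longrightarrow> y < real (card T) \<Longrightarrow> fourier_coeff n f T = 0"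
  shows "real (fdeg n f) \<le> y"
proof -
  let ?S = "insert 0 {card S | S. S \<subseteq> {..<n} \<and> fourier_coeff n f S \<noteq> 0}"
  have "finite ?S" by simp
  then have "fdeg n f \<in> ?S" unfolding fdeg_def by (intro Max_in) auto
  moreover have "real k \<le> y" if "k \<in> ?S" for k
    using that assms by (auto simp flip: not_less)
  ultimately show ?thesis by blast
qed

lemma approx_deg_le_fdeg:
  "(\<And>x. x \<subseteq> {..<n} \<Longrightarrow> \<bar>f x - g x\<bar> \<le> \<epsilon>) \<Longrightarrow> approx_deg n \<epsilon> f \<le> fdeg n g"
  unfolding approx_deg_def by (rule Least_le) auto

lemma fdeg_accept_prob_le:
  assumes V: "V \<in> operators (n + a)" and "0 \<le> y"
    and deg: "op_degree_le (n + a) y (heisenberg V (proj_one (n + a)))"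
  shows "real (fdeg n (accept_prob n a V \<phi>)) \<le> y"
  using fourier_coeff_expectation_eq_0[OF deg] \<open>0 \<le> y\<close>
  unfolding accept_prob_heisenberg[OF V, abs_def] by (rule fdeg_le[rotated])

subsection \<open>The degree bound\<close>

lemma qac0_compose_cong:
  "(\<And>i. i \<in> {1..j} \<Longrightarrow> M i = M' i) \<Longrightarrow> qac0_compose L M j = qac0_compose L M' j"
  by (induction j) simp_all

locale layered_circuit =
  fixes m d :: nat and L :: "nat \<Rightarrow> complex mat" and F :: "nat \<Rightarrow> nat set set"
  assumes single_qubit_layer: "\<And>i. i \<le> d \<Longrightarrow> is_single_qubit_layer m (L i)"
    and gates_subset: "\<And>i. i \<in> {1..d} \<Longrightarrow> \<Union>(F i) \<subseteq> {..<m}"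
    and gates_disjoint: "\<And>i. i \<in> {1..d} \<Longrightarrow> disjoint (F i)"
begin

abbreviation circuit_with :: "(nat \<Rightarrow> nat set \<Rightarrow> real) \<Rightarrow> complex mat" where
  "circuit_with h \<equiv> qac0_compose L (\<lambda>i. diag_op m (h i)) d"

lemma circuit_with_carrier: "circuit_with h \<in> operators m"
  using single_qubit_layer
  by (auto intro!: qac0_compose_carrier intro: is_single_qubit_layer_carrier)

lemma circuit_with_approx:
  fixes K y :: real
  assumes K: "24 * real l * real m \<le> K" "3 * real m \<le> K" "0 < K" and y: "0 < y"
  obtains h where "\<And>i X. i \<in> {1..d} \<Longrightarrow> \<bar>h i X\<bar> \<le> 1"
    and "\<And>i X. i \<in> {1..d} \<Longrightarrow> \<bar>h i X - cz_signs (F i) X\<bar> \<le> 2 * real m / 4 ^ l"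
    and "\<And>A. op_degree_le m y A \<Longrightarrow>
      op_degree_le m (K * (y / K) powr (1 / 3 ^ d)) (heisenberg (circuit_with h) A)"
proof -
  define z where "z i = K * (y / K) powr (1 / 3 ^ (d - i))" for i
  have z: "z i powr (1/3) * K powr (2/3) = z (i - 1)" if "i \<in> {1..d}" for i
  proof -
    have "d - (i - 1) = Suc (d - i)" using that by auto
    then show ?thesis using powr_third_recurrence[OF K(3) y, of "d - i"] by (simp add: z_def)
  qed
  have z_pos: "0 < z i" for i using K(3) y by (simp add: z_def)
  have "\<exists>h. (\<forall>X. \<bar>h X\<bar> \<le> 1) \<and> (\<forall>X. \<bar>h X - cz_signs (F i) X\<bar> \<le> 2 * real m / 4 ^ l) \<and>
      (\<forall>A. op_degree_le m (z i) A \<longrightarrow> op_degree_le m (z (i - 1)) (heisenberg (diag_op m h) A))"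
    if i: "i \<in> {1..d}" for i
    using cz_signs_approx[OF gates_subset[OF i] gates_disjoint[OF i] K(1,2) z_pos[of i]] z[OF i]
    by metis
  then obtain h where h: "\<And>i X. i \<in> {1..d} \<Longrightarrow> \<bar>h i X\<bar> \<le> 1"
    "\<And>i X. i \<in> {1..d} \<Longrightarrow> \<bar>h i X - cz_signs (F i) X\<bar> \<le> 2 * real m / 4 ^ l"
    "\<And>i A. i \<in> {1..d} \<Longrightarrow> op_degree_le m (z i) A \<Longrightarrow>
      op_degree_le m (z (i - 1)) (heisenberg (diag_op m (h i)) A)"
    by metis
  have "op_degree_le m (z 0) (heisenberg (circuit_with h) A)" if "op_degree_le m (z d) A" for A
    by (rule op_degree_le_qac0_compose[where y = z])
      (use single_qubit_layer h(3) that in simp_all)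
  moreover have "z d = y" "z 0 = K * (y / K) powr (1 / 3 ^ d)"
    using K(3) y by (simp_all add: z_def)
  ultimately show ?thesis using that[OF h(1,2)] by simp
qed

end

lemma qac0_circuitE:
  assumes "qac0_circuit m d U"
  obtains L F where "layered_circuit m d L F"
    and "U = qac0_compose L (\<lambda>i. diag_op m (cz_signs (F i))) d"
proof -
  obtain L M where L: "\<And>i. i \<le> d \<Longrightarrow> is_single_qubit_layer m (L i)"
    and M: "\<And>i. i \<in> {1..d} \<Longrightarrow> is_cz_layer m (M i)" and U: "U = qac0_compose L M d"
    using assms unfolding qac0_circuit_def by blast
  have "\<exists>F. \<Union>F \<subseteq> {..<m} \<and> disjoint F \<and> M i = diag_op m (cz_signs F)" if "i \<in> {1..d}" for i
    using M[OF that] unfolding is_cz_layer_def cz_layer_eq_diag_op disjoint_def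
    by (metis Union_least)
  then obtain F where F: "\<And>i. i \<in> {1..d} \<Longrightarrow> \<Union>(F i) \<subseteq> {..<m} \<and> disjoint (F i)"
    and MF: "\<And>i. i \<in> {1..d} \<Longrightarrow> M i = diag_op m (cz_signs (F i))"
    by metis
  show ?thesis
  proof
    show "layered_circuit m d L F" using L F by unfold_locales auto
    show "U = qac0_compose L (\<lambda>i. diag_op m (cz_signs (F i))) d"
      unfolding U by (rule qac0_compose_cong) (rule MF)
  qed
qed

lemma qac0_circuit_approx:
  fixes K y :: real
  assumes circuit: "qac0_circuit m d U"
    and K: "24 * real l * real m \<le> K" "3 * real m \<le> K" "0 < K" and y: "0 < y"
  obtains V where "U \<in> operators m" "V \<in> operators m"
    and "\<And>A. op_degree_le m y A \<Longrightarrow> op_degree_le m (K * (y / K) powr (1 / 3 ^ d)) (heisenberg V A)"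
    and "\<And>\<rho>. density_operator m \<rho> \<Longrightarrow> state_norm \<rho> U \<le> 1 \<and> state_norm \<rho> V \<le> 1 \<and>
      state_norm \<rho> (U - V) \<le> real d * (2 * real m / 4 ^ l)"
proof -
  obtain L F where "layered_circuit m d L F"
    and U: "U = qac0_compose L (\<lambda>i. diag_op m (cz_signs (F i))) d"
    using qac0_circuitE[OF circuit] by metis
  then interpret layered_circuit m d L F by simp
  obtain h where h: "\<And>i X. i \<in> {1..d} \<Longrightarrow> \<bar>h i X\<bar> \<le> 1"
    "\<And>i X. i \<in> {1..d} \<Longrightarrow> \<bar>h i X - cz_signs (F i) X\<bar> \<le> 2 * real m / 4 ^ l"
    "\<And>A. op_degree_le m y A \<Longrightarrow>
      op_degree_le m (K * (y / K) powr (1 / 3 ^ d)) (heisenberg (circuit_with h) A)"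
    using circuit_with_approx[OF K y] by blast
  have "state_norm \<rho> U \<le> 1 \<and> state_norm \<rho> (circuit_with h) \<le> 1 \<and>
      state_norm \<rho> (U - circuit_with h) \<le> real d * (2 * real m / 4 ^ l)"
    if "density_operator m \<rho>" for \<rho>
  proof -
    from that interpret state m \<rho> by unfold_locales
    show ?thesis
      unfolding U using single_qubit_layer h(1,2)
      by (intro conjI state_norm_qac0_compose_le_1 state_norm_qac0_compose_diff_le)
        (simp_all add: abs_minus_commute)
  qed
  with that[of "circuit_with h"] h(3) show ?thesis by (simp add: U circuit_with_carrier)
qed

lemma approx_deg_accept_prob_le:
  fixes K :: real
  assumes n: "n \<ge> 1" and circuit: "qac0_circuit (n + a) d U" and \<phi>: "density_operator a \<phi>"
    and K: "24 * real l * real (n + a) \<le> K" "3 * real (n + a) \<le> K"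
    and \<epsilon>: "2 * (real d * (2 * real (n + a) / 4 ^ l)) \<le> \<epsilon>"
  shows "real (approx_deg n \<epsilon> (accept_prob n a U \<phi>)) \<le> K powr (1 - 1 / 3 ^ d)"
proof -
  have "0 < 3 * real (n + a)" using n by simp
  then have "0 < K" using K(2) by linarith
  obtain V where V: "U \<in> operators (n + a)" "V \<in> operators (n + a)"
    "\<And>A. op_degree_le (n + a) 1 A \<Longrightarrow>
      op_degree_le (n + a) (K * (1 / K) powr (1 / 3 ^ d)) (heisenberg V A)"
    "\<And>\<rho>. density_operator (n + a) \<rho> \<Longrightarrow> state_norm \<rho> U \<le> 1 \<and> state_norm \<rho> V \<le> 1 \<and>
      state_norm \<rho> (U - V) \<le> real d * (2 * real (n + a) / 4 ^ l)"
    using qac0_circuit_approx[OF circuit K \<open>0 < K\<close>, of 1] by auto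
  have "\<bar>accept_prob n a U \<phi> x - accept_prob n a V \<phi> x\<bar> \<le> \<epsilon>" if x: "x \<subseteq> {..<n}" for x
    using accept_prob_diff_le[OF V(1,2) \<phi> x] V(4)[OF density_operator_input_state[OF \<phi> x]] \<epsilon>
    by (meson order_trans)
  then have "real (approx_deg n \<epsilon> (accept_prob n a U \<phi>)) \<le> real (fdeg n (accept_prob n a V \<phi>))"
    by (simp add: approx_deg_le_fdeg)
  also have "\<dots> \<le> K * (1 / K) powr (1 / 3 ^ d)"
  proof (rule fdeg_accept_prob_le[OF V(2) _ V(3)])
    show "op_degree_le (n + a) 1 (proj_one (n + a))"
      unfolding proj_one_eq_diag_op using n by (intro op_degree_le_diag_indicator) simp
  qed (use \<open>0 < K\<close> in simp)
  also have "\<dots> = K powr (1 - 1 / 3 ^ d)"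
    using \<open>0 < K\<close> by (simp add: powr_diff powr_divide)
  finally show ?thesis .
qed

lemma ex_logarithmic_exponent:
  fixes N :: real
  assumes "N \<ge> 1"
  obtains l :: nat where "real l \<le> 2 * (1 + ln N)" and "(2 * N)\<^sup>2 \<le> 4 ^ l"
proof -
  define l where "l = nat \<lceil>log 2 (2 * N)\<rceil>"
  have "ln 2 \<ge> (1/2 :: real)" using ln_le_minus_one[of "1/2 :: real"] by (simp add: ln_div)
  then have "ln N / ln 2 \<le> ln N / (1/2)" using assms by (intro divide_left_mono) auto
  moreover have "log 2 (2 * N) = 1 + ln N / ln 2"
    using assms by (simp add: log_def ln_mult add_divide_distrib)
  ultimately have "log 2 (2 * N) \<le> 1 + 2 * ln N" by simp
  moreover have "0 \<le> log 2 (2 * N)" using assms by simp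
  then have "real l \<le> log 2 (2 * N) + 1" unfolding l_def by linarith
  ultimately have "real l \<le> 2 * (1 + ln N)" by argo
  moreover have "(2 * N)\<^sup>2 \<le> 4 ^ l"
  proof -
    have "2 * N = 2 powr log 2 (2 * N)" using assms by simp
    also have "\<dots> \<le> 2 powr real l" by (intro powr_mono) (simp_all add: l_def real_nat_ceiling_ge)
    finally have "2 * N \<le> 2 ^ l" by (simp add: powr_realpow)
    then have "(2 * N)\<^sup>2 \<le> (2 ^ l)\<^sup>2" using assms by (intro power_mono) auto
    then show ?thesis by (simp flip: power_mult_distrib add: power2_eq_square)
  qed
  ultimately show ?thesis by (rule that)
qed

lemma powr_le_mult_powr:
  fixes B N x s :: real
  assumes "0 \<le> x" "x \<le> B * N" "1 \<le> B" "0 \<le> s" "s \<le> 1"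
  shows "x powr s \<le> B * N powr s"
proof -
  have "x powr s \<le> (B * N) powr s" using assms by (intro powr_mono2) auto
  also have "\<dots> = B powr s * N powr s" by (rule powr_mult)
  also have "\<dots> \<le> B powr 1 * N powr s" using assms by (intro mult_right_mono powr_mono) auto
  finally show ?thesis using assms by simp
qed

theorem theorem4p1:
  shows "\<exists>C c (k::nat). C > 0 \<and> c > 0 \<and>
    (\<forall>n a d U \<phi>. n \<ge> 1 \<longrightarrow> qac0_circuit (n + a) d U \<longrightarrow> density_operator a \<phi> \<longrightarrow>
       real (approx_deg n (c * real d / real n) (accept_prob n a U \<phi>))
         \<le> C * real (n + a) powr (1 - 1 / 3 ^ d) * (1 + ln (real (n + a))) ^ k)"
proof (rule exI[of _ 48], rule exI[of _ 1], rule exI[of _ 1], intro conjI allI impI)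
  fix n a d U \<phi>
  assume n: "n \<ge> 1" and circuit: "qac0_circuit (n + a) d U" and \<phi>: "density_operator a \<phi>"
  define N K where "N = real (n + a)" and "K = 48 * (1 + ln N) * N"
  have N: "1 \<le> N" "real n \<le> N" "0 \<le> ln N" using n by (simp_all add: N_def)
  obtain l :: nat where l: "real l \<le> 2 * (1 + ln N)" "(2 * N)\<^sup>2 \<le> 4 ^ l"
    using ex_logarithmic_exponent[OF N(1)] .
  have "24 * N * real l \<le> 24 * N * (2 * (1 + ln N))" "0 \<le> ln N * N"
    using l(1) N by (auto intro: mult_left_mono)
  then have K: "24 * real l * N \<le> K" "3 * N \<le> K" using N(1) by (simp_all add: K_def algebra_simps)
  have "2 * (real d * (2 * N / 4 ^ l)) \<le> 2 * (real d * (2 * N / (2 * N)\<^sup>2))"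
    using l(2) N by (intro mult_left_mono divide_left_mono) auto
  also have "\<dots> \<le> 1 * real d / real n"
    using N n by (simp add: power2_eq_square frac_le)
  finally have \<epsilon>: "2 * (real d * (2 * N / 4 ^ l)) \<le> 1 * real d / real n" .
  have "real (approx_deg n (1 * real d / real n) (accept_prob n a U \<phi>)) \<le> K powr (1 - 1 / 3 ^ d)"
    using approx_deg_accept_prob_le[OF n circuit \<phi>] K \<epsilon> by (simp add: N_def)
  also have "\<dots> \<le> (48 * (1 + ln N)) * N powr (1 - 1 / 3 ^ d)"
    using N by (intro powr_le_mult_powr) (simp_all add: K_def)
  finally show "real (approx_deg n (1 * real d / real n) (accept_prob n a U \<phi>))
      \<le> 48 * real (n + a) powr (1 - 1 / 3 ^ d) * (1 + ln (real (n + a))) ^ 1"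
    by (simp add: N_def algebra_simps)
qed simp_all

end
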